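(* Let $X$ be a transient diffusion on $(0,\infty)$ with coefficients $a,b$, scale function $\mathfrak{s}$ and speed measure $\mathfrak{m}$ as in the context, let $z>0$, and let $c(x)=1-2\bigl(\frac{\mathfrak{s}(x)}{\mathfrak{s}(z)}\wedge 1\bigr)$ for $x>0$. Let $r_*>0$ be the solution of $\int_0^{r_*}c(y)\,\mathfrak{m}(dy)=0$, and define $$\widetilde V(x)=\begin{cases}-\displaystyle\int_0^x\mathfrak{s}(x)c(y)\,\mathfrak{m}(dy)-\int_x^{r_*}\mathfrak{s}(y)c(y)\,\mathfrak{m}(dy)&\text{if }x\le r_*,\\[2mm]0&\text{if }x\ge r_*,\end{cases}$$ for $x>0$. If the origin is a natural boundary for $X$, then $\widetilde V$ solves the boundary-value problem $$\tfrac12a^2(x)\widetilde V''(x)+b(x)\widetilde V'(x)=-c(x)\quad\text{for all }x\in(0,r_* ),$$ $$\widetilde V(r_*-)=0,\qquad \widetilde V'(r_*-)=0,\qquad \widetilde V(0+)=-\infty.$$ If instead the origin is an entrance boundary for $X$, then the same holds with the last condition replaced by $\widetilde V(0+)>-\infty$.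
   Context: Let $a:(0,\infty)\to(0,\infty)$ and $b:(0,\infty)\to[0,\infty)$ be (Borel) functions such that for every $x>0$ there is $\varepsilon>0$ with $\int_{x-\varepsilon}^{x+\varepsilon}\frac{1+|b(y)|}{a^2(y)}\,dy<\infty$, and let $X$ be the non-negative weak solution (unique in law, up to its possibly infinite explosion time) of $dX_t=b(X_t)\,dt+a(X_t)\,dB_t$, with $B$ a standard Brownian motion. The scale function and speed measure are $$\mathfrak{s}(x)=\int^x e^{-\int^y\frac{2b(\xi)}{a^2(\xi)}\,d\xi}\,dy,\qquad \mathfrak{m}(dx)=\frac{2\,dx}{a^2(x)\mathfrak{s}'(x)},\qquad x>0,$$ with lower limits of integration (integration constants) fixed so that the following standing assumptions hold: $$\mathfrak{s}(0+)=-\infty,\qquad \mathfrak{s}(\infty-)=0,\qquad \int_0^1\mathfrak{m}(dy)<\infty.$$ Under these assumptions the origin is, in Feller's boundary classification, either a (non-attractive) natural boundary, which is the case $\int_0^1(\mathfrak{s}(1)-\mathfrak{s}(y))\,\mathfrak{m}(dy)=\infty$, or an entrance boundary, which is the case $\int_0^1(\mathfrak{s}(1)-\mathfrak{s}(y))\,\mathfrak{m}(dy)<\infty$. Notation: $g(y\pm)$ denotes the right/left limit of $g$ at $y$.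
   Formalization: Since a, b are only Borel, the equation "for all x in (0,r_* )" can fail at single points; it is proved for almost every x and at every x where a and b are continuous, with V' existing everywhere on (0,r_* ) and locally absolutely continuous. *)

theory Defs
  imports "HOL-Analysis.Analysis"
begin

definition locally_integrable_coeffs :: "(real \<Rightarrow> real) \<Rightarrow> (real \<Rightarrow> real) \<Rightarrow> bool" where
  "locally_integrable_coeffs a b \<longleftrightarrow>
     (\<forall>x>0. \<exists>\<epsilon>. 0 < \<epsilon> \<and> \<epsilon> < x \<and>
        set_integrable lborel {x - \<epsilon>..x + \<epsilon>} (\<lambda>y. (1 + \<bar>b y\<bar>) / (a y)\<^sup>2))"

text \<open>The scale function, with the integration constants made explicit: \<open>\<kappa>\<close> is the constant of the
  inner integral and \<open>K\<close> that of the outer one. The base point 1 is immaterial, since moving the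
  lower limits (also to an endpoint where the integrals converge) only changes \<open>\<kappa>\<close> and \<open>K\<close>.\<close>

definition scale_fun :: "(real \<Rightarrow> real) \<Rightarrow> (real \<Rightarrow> real) \<Rightarrow> real \<Rightarrow> real \<Rightarrow> real \<Rightarrow> real" where
  "scale_fun a b \<kappa> K x =
     K + (LBINT y=ereal 1..ereal x. exp (\<kappa> - (LBINT \<xi>=ereal 1..ereal y. 2 * b \<xi> / (a \<xi>)\<^sup>2)))"

definition speed_measure :: "(real \<Rightarrow> real) \<Rightarrow> (real \<Rightarrow> real) \<Rightarrow> real measure" where
  "speed_measure a s =
     density lborel (\<lambda>x. ennreal (indicator {0<..} x * (2 / ((a x)\<^sup>2 * deriv s x))))"

definition origin_natural :: "(real \<Rightarrow> real) \<Rightarrow> real measure \<Rightarrow> bool" where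
  "origin_natural s m \<longleftrightarrow> (\<integral>\<^sup>+ y\<in>{0<..1}. ennreal (s 1 - s y) \<partial>m) = \<infinity>"

definition origin_entrance :: "(real \<Rightarrow> real) \<Rightarrow> real measure \<Rightarrow> bool" where
  "origin_entrance s m \<longleftrightarrow> (\<integral>\<^sup>+ y\<in>{0<..1}. ennreal (s 1 - s y) \<partial>m) < \<infinity>"

definition cost :: "(real \<Rightarrow> real) \<Rightarrow> real \<Rightarrow> real \<Rightarrow> real" where
  "cost s z x = 1 - 2 * min (s x / s z) 1"

definition Vtilde :: "(real \<Rightarrow> real) \<Rightarrow> real measure \<Rightarrow> (real \<Rightarrow> real) \<Rightarrow> real \<Rightarrow> real \<Rightarrow> real" where
  "Vtilde s m c r x =
     (if x \<le> r
      then - (LINT y:{0<..x}|m. s x * c y) - (LINT y:{x..r}|m. s y * c y)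
      else 0)"

text \<open>The meaning of \<open>\<onehalf> a\<^sup>2 V'' + b V' = - c\<close> on \<open>(0, r)\<close>. The coefficients are only Borel, so that
  altering \<open>a\<close> at a single point changes neither the scale function nor the speed measure, and a
  pointwise equation cannot hold at literally every point. As usual for measurable coefficients,
  a solution has a classical first derivative everywhere, this derivative is locally absolutely
  continuous (second conjunct, in the form of the fundamental theorem of calculus), and the
  equation holds Lebesgue-almost everywhere. In addition, it is required to hold classically at
  every point at which \<open>a\<close> and \<open>b\<close> are continuous, so at all points if they are continuous.\<close>

definition solves_generator_ode ::
  "(real \<Rightarrow> real) \<Rightarrow> (real \<Rightarrow> real) \<Rightarrow> (real \<Rightarrow> real) \<Rightarrow> real \<Rightarrow> (real \<Rightarrow> real) \<Rightarrow> bool" where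
  "solves_generator_ode a b c r V \<longleftrightarrow>
     (\<forall>x\<in>{0<..<r}. V differentiable (at x)) \<and>
     (\<forall>u v. 0 < u \<longrightarrow> u \<le> v \<longrightarrow> v < r \<longrightarrow>
        deriv (deriv V) absolutely_integrable_on {u..v} \<and>
        integral {u..v} (deriv (deriv V)) = deriv V v - deriv V u) \<and>
     (AE x in lborel. x \<in> {0<..<r} \<longrightarrow>
        deriv V differentiable (at x) \<and>
        1/2 * (a x)\<^sup>2 * deriv (deriv V) x + b x * deriv V x = - c x) \<and>
     (\<forall>x\<in>{0<..<r}. isCont a x \<longrightarrow> isCont b x \<longrightarrow>
        deriv V differentiable (at x) \<and>
        1/2 * (a x)\<^sup>2 * deriv (deriv V) x + b x * deriv V x = - c x)"

end

theory Submission
  imports Defs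
begin

text \<open>Write \<open>f = c \<rho>\<close> with \<open>\<rho>\<close> the density of the speed measure, \<open>F(x) = \<integral>\<^sub>0\<^sup>x f\<close>, and let \<open>H\<close> be a primitive
  of \<open>s f\<close>. Then \<open>V = - s F + H - H(r)\<close> on \<open>(0, r]\<close>. Integrating \<open>s F\<close> by parts gives \<open>V' = - s' F\<close>, which is
  a product of indefinite integrals and vanishes at \<open>r\<close>; at every point where these are
  differentiable, hence almost everywhere by Lebesgue's differentiation theorem and at each continuity
  point of the coefficients, differentiating once more gives the equation. Near the origin \<open>c = -1\<close>, so
  \<open>V\<close> is increasing and equals a constant minus \<open>\<integral>\<^sub>0\<^sup>p \<bar>s(max x y)\<bar> \<rho>(y) dy\<close>, which stays
  bounded as \<open>x\<close> decreases to \<open>0\<close> precisely when \<open>\<bar>s\<bar> \<rho>\<close> is integrable at \<open>0\<close>.\<close>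

section \<open>Differentiation and chain rule for indefinite integrals\<close>

lemma integral_diff_eq_integral:
  fixes f :: "real \<Rightarrow> real"
  assumes "f integrable_on {a..b}" "a \<le> u" "u \<le> v" "v \<le> b"
  shows "integral {a..v} f - integral {a..u} f = integral {u..v} f"
proof -
  have "f integrable_on {a..v}"
    by (rule integrable_on_subinterval[OF assms(1)]) (use assms in auto)
  from Henstock_Kurzweil_Integration.integral_combine[OF assms(2,3) this]
  show ?thesis by simp
qed

text \<open>The outer absolute values make the bound independent of the order of \<open>x\<close>
  and \<open>y\<close>, as is needed when increments are taken on both sides of a base
  point.\<close>

lemma abs_integral_diff_le:
  fixes f g :: "real \<Rightarrow> real"
  assumes f: "f integrable_on {a..b}" and g: "g integrable_on {a..b}"
    and xy: "x \<in> {a..b}" "y \<in> {a..b}"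
    and le: "\<And>t. t \<in> closed_segment x y \<Longrightarrow> \<bar>f t\<bar> \<le> g t"
  shows "\<bar>integral {a..y} f - integral {a..x} f\<bar> \<le> \<bar>integral {a..y} g - integral {a..x} g\<bar>"
proof -
  have *: "\<bar>integral {a..v} f - integral {a..u} f\<bar> \<le> integral {a..v} g - integral {a..u} g"
    if "a \<le> u" "u \<le> v" "v \<le> b" and le: "\<And>t. t \<in> {u..v} \<Longrightarrow> \<bar>f t\<bar> \<le> g t" for u v
  proof -
    have "f integrable_on {u..v}" "g integrable_on {u..v}"
      using f g that by (auto elim!: integrable_on_subinterval)
    then have "norm (integral {u..v} f) \<le> integral {u..v} g"
      by (rule integral_norm_bound_integral) (use le in auto)
    then show ?thesis
      using that by (simp add: integral_diff_eq_integral[OF f] integral_diff_eq_integral[OF g])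
  qed
  show ?thesis
  proof (cases "x \<le> y")
    case True
    then show ?thesis
      using *[of x y] xy le by (force simp: closed_segment_eq_real_ivl)
  next
    case False
    then show ?thesis
      using *[of y x] xy le by (force simp: closed_segment_eq_real_ivl)
  qed
qed


text \<open>Where differentiability fails, arbitrarily short intervals ending at the point have a
  Riemann error above a fixed rate \<open>e\<close> times their length. Henstock's lemma limits the
  total error of disjoint fine intervals, hence their total length, and Vitali's theorem shows that
  such intervals cover the bad points up to a null set.\<close>

lemma has_real_derivative_indefinite_integral_AE:
  fixes f :: "real \<Rightarrow> real"
  assumes f: "f integrable_on {a..b}"
  shows "negligible {x \<in> {a<..<b}. \<not> ((\<lambda>u. integral {a..u} f) has_real_derivative f x) (at x)}"
proof -
  define G where "G u = integral {a..u} f" for u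
  \<comment> \<open>\<open>R x y\<close> is the Riemann error of the interval between
    \<open>x\<close> and \<open>y\<close> tagged at \<open>x\<close>; the derivative of
    \<open>G\<close> at \<open>x\<close> is \<open>f x\<close> iff it is o(|y - x|).\<close>
  define R where "R x y = \<bar>G y - G x - f x * (y - x)\<bar>" for x y
  define bad where "bad e = {x \<in> {a<..<b}. \<forall>d>0. \<exists>y\<in>{a..b}. y \<noteq> x \<and> \<bar>y - x\<bar> < d \<and> R x y > e * \<bar>y - x\<bar>}"
    for e
  have G_diff: "G v - G u = integral {u..v} f" if "a \<le> u" "u \<le> v" "v \<le> b" for u v
    using integral_diff_eq_integral[OF f that] by (simp add: G_def)
  have "negligible (bad e)" if "e > 0" for e
  proof (unfold negligible_outer_le, intro allI impI)
    fix \<epsilon> :: real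
    assume "\<epsilon> > 0"
    have "f integrable_on cbox a b" using f by simp
    \<comment> \<open>Each selected interval has error more than \<open>e\<close> times its length,
      so accuracy \<open>e * \<epsilon>\<close> leaves total length at most \<epsilon>.\<close>
    then obtain \<gamma> where "gauge \<gamma>"
      and \<gamma>: "\<And>p. p tagged_partial_division_of (cbox a b) \<Longrightarrow> \<gamma> fine p \<Longrightarrow>
             sum (\<lambda>(x,k). norm (measure lborel k *\<^sub>R f x - integral k f)) p < e * \<epsilon>"
      by (rule Henstock_lemma[where e = "e * \<epsilon>"]) (use \<open>e > 0\<close> \<open>\<epsilon> > 0\<close> in auto)
    \<comment> \<open>The covering theorem asks for balls; a pair \<open>(x, y)\<close> codes the
      interval between the bad point \<open>x\<close>, which becomes the tag, and its witness
      \<open>y\<close>.\<close>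
    define ctr :: "real \<times> real \<Rightarrow> real" where "ctr = (\<lambda>(x, y). (x + y) / 2)"
    define rad :: "real \<times> real \<Rightarrow> real" where "rad = (\<lambda>(x, y). \<bar>y - x\<bar> / 2)"
    define B where "B i = cball (ctr i) (rad i)" for i
    have B_eq: "B (x, y) = {min x y..max x y}" for x y
    proof -
      have "(x + y) / 2 - \<bar>y - x\<bar> / 2 = min x y" "(x + y) / 2 + \<bar>y - x\<bar> / 2 = max x y"
        by (auto simp: min_def max_def abs_if field_simps)
      then show ?thesis
        by (simp add: B_def ctr_def rad_def cball_eq_atLeastAtMost)
    qed
    define K where "K = {(x, y). x \<in> bad e \<and> y \<in> {a..b} \<and> y \<noteq> x \<and> R x y > e * \<bar>y - x\<bar>
                                  \<and> B (x, y) \<subseteq> \<gamma> x}"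
    text \<open>A Vitali subcover by intervals with one endpoint in the bad set is a tagged partial
      division, to which Henstock's lemma applies.\<close>
    obtain C where C: "countable C" "C \<subseteq> K"
      "pairwise (\<lambda>i j. disjnt (cball (ctr i) (rad i)) (cball (ctr j) (rad j))) C"
      "negligible (bad e - (\<Union>i\<in>C. cball (ctr i) (rad i)))"
    proof (rule Vitali_covering_theorem_cballs[of K rad "bad e" ctr])
      show "0 < rad i" if "i \<in> K" for i
        using that by (auto simp: K_def rad_def)
      fix x d :: real
      assume x: "x \<in> bad e" and "0 < d"
      obtain d' where "d' > 0" and d': "ball x d' \<subseteq> \<gamma> x"
        using \<open>gauge \<gamma>\<close> by (metis gauge_def openE)
      obtain y where y: "y \<in> {a..b}" "y \<noteq> x" "\<bar>y - x\<bar> < min d d'" "R x y > e * \<bar>y - x\<bar>"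
      proof -
        have "min d d' > 0" using \<open>0 < d\<close> \<open>d' > 0\<close> by simp
        with x have "\<exists>y\<in>{a..b}. y \<noteq> x \<and> \<bar>y - x\<bar> < min d d' \<and> R x y > e * \<bar>y - x\<bar>"
          unfolding bad_def by blast
        then show ?thesis using that by blast
      qed
      have "B (x, y) \<subseteq> ball x d'"
        using y(3) by (auto simp: B_eq dist_real_def)
      then have "(x, y) \<in> K"
        using x y d' by (auto simp: K_def)
      moreover have "x \<in> B (x, y)" "rad (x, y) < d"
        using y(2,3) by (auto simp: B_eq rad_def)
      ultimately show "\<exists>i. i \<in> K \<and> x \<in> cball (ctr i) (rad i) \<and> rad i < d"
        unfolding B_def by blast
    qed
    have B_real: "B i \<in> lmeasurable" "measure lebesgue (B i) = \<bar>snd i - fst i\<bar>" for i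
      by (cases i; simp add: B_eq min_def max_def)+
    have finite_sum: "(\<Sum>i\<in>D. measure lebesgue (B i)) \<le> \<epsilon>" if "D \<subseteq> C" "finite D" for D
    proof -
      define p where "p = (\<lambda>i. (fst i, B i)) ` D"
      have K: "fst i \<in> {a<..<b}" "snd i \<in> {a..b}" "snd i \<noteq> fst i"
        "R (fst i) (snd i) > e * \<bar>snd i - fst i\<bar>" "B i \<subseteq> \<gamma> (fst i)" if "i \<in> D" for i
        using that \<open>D \<subseteq> C\<close> \<open>C \<subseteq> K\<close> by (force simp: K_def bad_def)+
      have disj: "disjnt (B i) (B j)" if "i \<in> D" "j \<in> D" "i \<noteq> j" for i j
        using C(3) that \<open>D \<subseteq> C\<close> unfolding pairwise_def B_def by blast
      have nonempty: "fst i \<in> B i" for i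
        by (cases i) (auto simp: B_eq)
      \<comment> \<open>Disjoint nonempty intervals are distinct, so a sum over \<open>p\<close> is
        a sum over \<open>D\<close>.\<close>
      have inj: "inj_on (\<lambda>i. (fst i, B i)) D"
        using disj nonempty by (force simp: inj_on_def disjnt_iff)
      have "p tagged_partial_division_of cbox a b"
        unfolding tagged_partial_division_of_def
      proof (intro conjI allI impI)
        show "finite p" using \<open>finite D\<close> by (simp add: p_def)
        fix x k assume "(x, k) \<in> p"
        then obtain i where i: "i \<in> D" "x = fst i" "k = B i" by (auto simp: p_def)
        show "x \<in> k" using i nonempty by simp
        show "k \<subseteq> cbox a b" using i K[of i] by (cases i) (auto simp: B_eq)
        show "\<exists>a b. k = cbox a b" using i by (cases i) (auto simp: B_eq intro!: exI)
      next
        fix x k x' k' assume "(x, k) \<in> p \<and> (x', k') \<in> p \<and> (x, k) \<noteq> (x', k')"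
        then obtain i where i: "i \<in> D" "x = fst i" "k = B i" by (auto simp: p_def)
        from \<open>(x, k) \<in> p \<and> _\<close> obtain j
          where j: "j \<in> D" "x' = fst j" "k' = B j" by (auto simp: p_def)
        then have "disjnt k k'" using disj i \<open>(x, k) \<in> p \<and> _\<close> by blast
        then show "interior k \<inter> interior k' = {}"
          using interior_subset by (fastforce simp: disjnt_def)
      qed
      moreover have "\<gamma> fine p"
        using K(5) by (auto simp: fine_def p_def)
      ultimately have "sum (\<lambda>(x,k). norm (measure lborel k *\<^sub>R f x - integral k f)) p < e * \<epsilon>"
        by (rule \<gamma>)
      also have "sum (\<lambda>(x,k). norm (measure lborel k *\<^sub>R f x - integral k f)) p
        = (\<Sum>i\<in>D. \<bar>measure lborel (B i) * f (fst i) - integral (B i) f\<bar>)"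
        unfolding p_def by (subst sum.reindex[OF inj]) simp
      finally have "(\<Sum>i\<in>D. \<bar>measure lborel (B i) * f (fst i) - integral (B i) f\<bar>) < e * \<epsilon>" .
      moreover have "\<bar>measure lborel (B i) * f (fst i) - integral (B i) f\<bar> = R (fst i) (snd i)" if "i \<in> D" for i
      proof (cases i)
        case (Pair x y)
        show ?thesis
        proof (cases "x \<le> y")
          case True
          then have "integral {x..y} f = G y - G x"
            using G_diff[of x y] K[OF that] Pair by auto
          then show ?thesis using True by (simp add: Pair B_eq R_def algebra_simps min_def max_def)
        next
          case False
          then have "integral {y..x} f = G x - G y"
            using G_diff[of y x] K[OF that] Pair by auto
          then show ?thesis using False by (simp add: Pair B_eq R_def algebra_simps min_def max_def)
        qed
      qed
      ultimately have "(\<Sum>i\<in>D. R (fst i) (snd i)) < e * \<epsilon>" by simp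
      moreover have "(\<Sum>i\<in>D. e * measure lebesgue (B i)) \<le> (\<Sum>i\<in>D. R (fst i) (snd i))"
        using K(4) by (intro sum_mono) (force simp: B_real)
      ultimately have "e * (\<Sum>i\<in>D. measure lebesgue (B i)) < e * \<epsilon>"
        by (simp add: sum_distrib_left)
      then show ?thesis using \<open>e > 0\<close> by simp
    qed
    have finite_UN: "measure lebesgue (\<Union>i\<in>D. B i) \<le> \<epsilon>" if "D \<subseteq> C" "finite D" for D
      using finite_sum[OF that] measure_UNION_le[OF that(2), of B lebesgue] B_real(1)
      by (fastforce dest: fmeasurableD)
    \<comment> \<open>A bound uniform over finite subfamilies passes to the countable union.\<close>
    have U: "(\<Union>i\<in>C. B i) \<in> lmeasurable" "measure lebesgue (\<Union>i\<in>C. B i) \<le> \<epsilon>"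
      using fmeasurable_UN_bound[OF C(1) B_real(1) finite_UN] measure_UN_bound[OF C(1) B_real(1) finite_UN]
      by auto
    let ?N = "bad e - (\<Union>i\<in>C. B i)"
    have N: "negligible ?N" using C(4) by (simp add: B_def)
    show "\<exists>T. bad e \<subseteq> T \<and> T \<in> lmeasurable \<and> measure lebesgue T \<le> \<epsilon>"
    proof (intro exI conjI)
      show "bad e \<subseteq> (\<Union>i\<in>C. B i) \<union> ?N" by auto
      show "(\<Union>i\<in>C. B i) \<union> ?N \<in> lmeasurable"
        using U N by (intro fmeasurable.Un) (auto simp: negligible_imp_measurable)
      have "measure lebesgue ((\<Union>i\<in>C. B i) \<union> ?N) \<le> measure lebesgue (\<Union>i\<in>C. B i) + measure lebesgue ?N"
        using U N by (intro measure_Un_le) (auto simp: negligible_imp_measurable fmeasurableD)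
      then show "measure lebesgue ((\<Union>i\<in>C. B i) \<union> ?N) \<le> \<epsilon>"
        using U N by (simp add: negligible_imp_measure0)
    qed
  qed
  then have "negligible (\<Union>n. bad (inverse (Suc n)))"
    by (intro negligible_countable_Union) auto
  then show ?thesis
  proof (rule negligible_subset, safe)
    fix x assume x: "x \<in> {a<..<b}"
      and "\<not> ((\<lambda>u. integral {a..u} f) has_real_derivative f x) (at x)"
    then have "\<not> (G has_derivative (\<lambda>h. f x * h)) (at x)"
      by (simp add: G_def[abs_def] has_field_derivative_def)
    then obtain e where "e > 0"
      and e: "\<And>d. d > 0 \<Longrightarrow> \<exists>y. \<bar>y - x\<bar> < d \<and> R x y > e * \<bar>y - x\<bar>"
      unfolding has_derivative_at_alt R_def by (auto simp: bounded_linear_mult_right not_le)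
    obtain n where n: "inverse (real (Suc n)) < e"
      using reals_Archimedean[OF \<open>e > 0\<close>] by auto
    have "x \<in> bad (inverse (Suc n))"
      unfolding bad_def
    proof (intro CollectI conjI x allI impI)
      fix d :: real assume "d > 0"
      \<comment> \<open>Staying closer to \<open>x\<close> than the endpoints are keeps the witness
        inside \<open>{a..b}\<close>.\<close>
      obtain y where y: "\<bar>y - x\<bar> < min d (min (x - a) (b - x))" "R x y > e * \<bar>y - x\<bar>"
        using e[of "min d (min (x - a) (b - x))"] x \<open>d > 0\<close> by auto
      have "y \<noteq> x" using y(2) by (auto simp: R_def)
      moreover have "R x y > inverse (Suc n) * \<bar>y - x\<bar>"
        using y(2) n mult_right_mono[of "inverse (real (Suc n))" e "\<bar>y - x\<bar>"] by linarith
      ultimately show "\<exists>y\<in>{a..b}. y \<noteq> x \<and> \<bar>y - x\<bar> < d \<and> R x y > inverse (Suc n) * \<bar>y - x\<bar>"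
        using y(1) x by (intro bexI[of _ y]) auto
    qed
    then show "x \<in> (\<Union>n. bad (inverse (Suc n)))" by auto
  qed
qed

section \<open>Chain rule for two indefinite integrals\<close>

text \<open>\<open>J\<close> takes the place of length in the mean value argument: for fixed
  \<epsilon> the local estimates add up over a bisection to \<open>\<epsilon> * (J b - J a)\<close>,
  and \<epsilon> is arbitrary.\<close>

lemma eq_if_increments_dominated:
  fixes e J :: "real \<Rightarrow> real"
  assumes "a \<le> b" and J: "mono_on {a..b} J"
    and local: "\<And>x \<epsilon>. x \<in> {a..b} \<Longrightarrow> \<epsilon> > 0 \<Longrightarrow>
      \<exists>\<delta>>0. \<forall>y\<in>{a..b}. \<bar>y - x\<bar> < \<delta> \<longrightarrow> \<bar>e y - e x\<bar> \<le> \<epsilon> * \<bar>J y - J x\<bar>"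
  shows "e b = e a"
proof -
  have *: "\<bar>e b - e a\<bar> \<le> \<epsilon> * (J b - J a)" if "\<epsilon> > 0" for \<epsilon>
  proof -
    \<comment> \<open>Bolzano's bisection principle quantifies over all reals; the premises make
      \<open>P\<close> vacuous outside \<open>{a..b}\<close>.\<close>
    define P where "P u v \<longleftrightarrow> (a \<le> u \<longrightarrow> u \<le> v \<longrightarrow> v \<le> b \<longrightarrow> \<bar>e v - e u\<bar> \<le> \<epsilon> * (J v - J u))" for u v
    have "P a b"
      using \<open>a \<le> b\<close>
    proof (rule Bolzano)
      fix u v w :: real
      assume uvw: "P u v" "P v w" "u \<le> v" "v \<le> w"
      show "P u w"
        unfolding P_def
      proof (intro impI)
        assume "a \<le> u" "w \<le> b"
        then have "\<bar>e v - e u\<bar> \<le> \<epsilon> * (J v - J u)" "\<bar>e w - e v\<bar> \<le> \<epsilon> * (J w - J v)"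
          using uvw by (auto simp: P_def)
        then show "\<bar>e w - e u\<bar> \<le> \<epsilon> * (J w - J u)"
          unfolding right_diff_distrib by linarith
      qed
    next
      fix x assume x: "a \<le> x" "x \<le> b"
      then obtain \<delta> where "\<delta> > 0"
        and \<delta>: "\<And>y. y \<in> {a..b} \<Longrightarrow> \<bar>y - x\<bar> < \<delta> \<Longrightarrow> \<bar>e y - e x\<bar> \<le> \<epsilon> * \<bar>J y - J x\<bar>"
        using local[of x \<epsilon>] \<open>\<epsilon> > 0\<close> by auto
      show "\<exists>d>0. \<forall>u v. u \<le> x \<and> x \<le> v \<and> v - u < d \<longrightarrow> P u v"
        unfolding P_def
      proof (intro exI[of _ \<delta>] conjI \<open>\<delta> > 0\<close> allI impI)
        fix u v assume uv: "u \<le> x \<and> x \<le> v \<and> v - u < \<delta>" "a \<le> u" "u \<le> v" "v \<le> b"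
        \<comment> \<open>Since \<open>x\<close> lies between \<open>u\<close> and \<open>v\<close>,
          the increments of \<open>J\<close> on its two sides are nonnegative and sum to
          \<open>J v - J u\<close>.\<close>
        have "J u \<le> J x" "J x \<le> J v"
          using uv x by (auto intro!: mono_onD[OF J])
        then have "\<bar>J u - J x\<bar> = J x - J u" "\<bar>J v - J x\<bar> = J v - J x" by auto
        moreover have "\<bar>e u - e x\<bar> \<le> \<epsilon> * \<bar>J u - J x\<bar>" "\<bar>e v - e x\<bar> \<le> \<epsilon> * \<bar>J v - J x\<bar>"
          using \<delta>[of u] \<delta>[of v] uv x by auto
        ultimately have "\<bar>e u - e x\<bar> \<le> \<epsilon> * (J x - J u)" "\<bar>e v - e x\<bar> \<le> \<epsilon> * (J v - J x)"
          by simp_all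
        then show "\<bar>e v - e u\<bar> \<le> \<epsilon> * (J v - J u)"
          unfolding right_diff_distrib by linarith
      qed
    qed
    then show ?thesis using \<open>a \<le> b\<close> by (simp add: P_def)
  qed
  have "J a \<le> J b" using \<open>a \<le> b\<close> by (auto intro: mono_onD[OF J])
  have "\<bar>e b - e a\<bar> \<le> 0"
  proof (rule field_le_epsilon)
    fix \<eta> :: real assume "\<eta> > 0"
    \<comment> \<open>The summand 1 keeps the denominator positive when \<open>J\<close> is
      constant.\<close>
    have "\<bar>e b - e a\<bar> \<le> \<eta> / (J b - J a + 1) * (J b - J a)"
      by (rule *) (use \<open>J a \<le> J b\<close> \<open>\<eta> > 0\<close> in auto)
    also have "\<dots> \<le> \<eta>"
      using \<open>J a \<le> J b\<close> \<open>\<eta> > 0\<close> by (simp add: field_simps)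
    finally show "\<bar>e b - e a\<bar> \<le> 0 + \<eta>" by simp
  qed
  then show ?thesis by simp
qed

lemma absolutely_integrable_continuous_mult:
  fixes f g :: "real \<Rightarrow> real"
  assumes "continuous_on {a..b} f" "g absolutely_integrable_on {a..b}"
  shows "(\<lambda>x. f x * g x) absolutely_integrable_on {a..b}"
  using assms
  by (intro absolutely_integrable_bounded_measurable_product_real)
     (auto intro!: compact_imp_bounded compact_continuous_image continuous_imp_measurable_on_sets_lebesgue)

text \<open>Over a short interval both the Taylor remainder of \<open>\<phi>\<close> and the variation of \<open>A\<close> and \<open>B\<close> under the
  integral are at most \<open>\<epsilon>\<close> times the increment of \<open>\<integral>(\<bar>p\<bar> + \<bar>q\<bar>)\<close>, and such errors add up to nothing.\<close>

lemma integral_chain_rule: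
  fixes \<phi> :: "real \<times> real \<Rightarrow> real" and P Q p q A B :: "real \<Rightarrow> real"
  assumes "a \<le> b"
    and p: "p absolutely_integrable_on {a..b}" and q: "q absolutely_integrable_on {a..b}"
    and P: "\<And>x. x \<in> {a..b} \<Longrightarrow> P x = P a + integral {a..x} p"
    and Q: "\<And>x. x \<in> {a..b} \<Longrightarrow> Q x = Q a + integral {a..x} q"
    and \<phi>: "\<And>x. x \<in> {a..b} \<Longrightarrow> (\<phi> has_derivative (\<lambda>h. A x * fst h + B x * snd h)) (at (P x, Q x))"
    and A: "continuous_on {a..b} A" and B: "continuous_on {a..b} B"
  shows "(\<lambda>x. A x * p x + B x * q x) absolutely_integrable_on {a..b}"
    and "integral {a..b} (\<lambda>x. A x * p x + B x * q x) = \<phi> (P b, Q b) - \<phi> (P a, Q a)"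
proof -
  define h where "h x = A x * p x + B x * q x" for x
  define j where "j x = \<bar>p x\<bar> + \<bar>q x\<bar>" for x
  define J where "J y = integral {a..y} j" for y
  \<comment> \<open>The assertion amounts to \<open>e\<close> having the same value at both
    ends.\<close>
  define e where "e y = \<phi> (P y, Q y) - integral {a..y} h" for y
  show h_abs: "(\<lambda>x. A x * p x + B x * q x) absolutely_integrable_on {a..b}"
    by (intro set_integral_add absolutely_integrable_continuous_mult A B p q)
  then have h: "h integrable_on {a..b}"
    by (auto simp: h_def[abs_def] set_lebesgue_integral_eq_integral)
  have p': "p integrable_on {a..b}" "(\<lambda>x. \<bar>p x\<bar>) integrable_on {a..b}"
    and q': "q integrable_on {a..b}" "(\<lambda>x. \<bar>q x\<bar>) integrable_on {a..b}"
    using p q by (auto simp: absolutely_integrable_on_def)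
  then have j: "j integrable_on {a..b}"
    by (auto simp: j_def[abs_def] intro!: integrable_add)
  have cont: "continuous_on {a..b} P" "continuous_on {a..b} Q"
  proof -
    have "continuous_on {a..b} (\<lambda>x. P a + integral {a..x} p)" "continuous_on {a..b} (\<lambda>x. Q a + integral {a..x} q)"
      by (intro continuous_on_add continuous_on_const indefinite_integral_continuous_1 p' q')+
    then show "continuous_on {a..b} P" "continuous_on {a..b} Q"
      using P Q by (metis (no_types, lifting) continuous_on_eq)+
  qed
  have "mono_on {a..b} J"
  proof (rule mono_onI)
    fix u v assume uv: "u \<in> {a..b}" "v \<in> {a..b}" "u \<le> v"
    have "0 \<le> integral {u..v} j"
      by (rule integral_nonneg) (use uv j in \<open>auto simp: j_def elim!: integrable_on_subinterval\<close>)
    then show "J u \<le> J v"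
      using integral_diff_eq_integral[OF j, of u v] uv by (simp add: J_def)
  qed
  moreover have "\<exists>\<delta>>0. \<forall>y\<in>{a..b}. \<bar>y - x\<bar> < \<delta> \<longrightarrow> \<bar>e y - e x\<bar> \<le> \<epsilon> * \<bar>J y - J x\<bar>"
    if x: "x \<in> {a..b}" and "\<epsilon> > 0" for x \<epsilon>
  proof -
    \<comment> \<open>The Taylor remainder costs \<epsilon>/4 for each of \<open>P\<close> and
      \<open>Q\<close>, and the variation of \<open>A\<close> and \<open>B\<close> costs another
      \<epsilon>/4, which stays below \<epsilon>.\<close>
    have "\<epsilon> / 4 > 0" using \<open>\<epsilon> > 0\<close> by simp
    obtain d where "d > 0" and d: "\<And>w. norm (w - (P x, Q x)) < d \<Longrightarrow>
        norm (\<phi> w - \<phi> (P x, Q x) - (A x * fst (w - (P x, Q x)) + B x * snd (w - (P x, Q x))))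
          \<le> \<epsilon> / 4 * norm (w - (P x, Q x))"
      using \<phi>[OF x] \<open>\<epsilon> / 4 > 0\<close> unfolding has_derivative_at_alt by blast
    have "continuous_on {a..b} (\<lambda>y. (P y, Q y))" by (intro continuous_intros cont)
    then obtain d1 where "d1 > 0" and d1: "\<And>y. y \<in> {a..b} \<Longrightarrow> dist y x < d1 \<Longrightarrow> dist (P y, Q y) (P x, Q x) < d"
      using x \<open>d > 0\<close> unfolding continuous_on_iff by blast
    obtain d2 where "d2 > 0" and d2: "\<And>y. y \<in> {a..b} \<Longrightarrow> dist y x < d2 \<Longrightarrow> dist (A y) (A x) < \<epsilon> / 4"
      using x A \<open>\<epsilon> / 4 > 0\<close> unfolding continuous_on_iff by blast
    obtain d3 where "d3 > 0" and d3: "\<And>y. y \<in> {a..b} \<Longrightarrow> dist y x < d3 \<Longrightarrow> dist (B y) (B x) < \<epsilon> / 4"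
      using x B \<open>\<epsilon> / 4 > 0\<close> unfolding continuous_on_iff by blast
    show ?thesis
    proof (intro exI[of _ "min d1 (min d2 d3)"] conjI ballI impI)
      show "min d1 (min d2 d3) > 0" using \<open>d1 > 0\<close> \<open>d2 > 0\<close> \<open>d3 > 0\<close> by simp
      fix y assume y: "y \<in> {a..b}" "\<bar>y - x\<bar> < min d1 (min d2 d3)"
      \<comment> \<open>The error of freezing the coefficients at \<open>x\<close>: its integral
        from \<open>x\<close> to \<open>y\<close> is the increment of the integral of
        \<open>h\<close> minus the linear term of \<phi> at \<open>x\<close>.\<close>
      define R where "R t = (A t - A x) * p t + (B t - B x) * q t" for t
      have P_bound: "\<bar>P y - P x\<bar> \<le> \<bar>J y - J x\<bar>"
        using abs_integral_diff_le[OF p'(1) j x y(1)] P[OF x] P[OF y(1)] by (simp add: J_def j_def)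
      have Q_bound: "\<bar>Q y - Q x\<bar> \<le> \<bar>J y - J x\<bar>"
        using abs_integral_diff_le[OF q'(1) j x y(1)] Q[OF x] Q[OF y(1)] by (simp add: J_def j_def)
      have "R absolutely_integrable_on {a..b}"
        unfolding R_def by (intro set_integral_add absolutely_integrable_continuous_mult p q continuous_intros A B)
      then have R: "R integrable_on {a..b}" by (simp add: set_lebesgue_integral_eq_integral)
      have "\<bar>integral {a..y} R - integral {a..x} R\<bar>
          \<le> \<bar>integral {a..y} (\<lambda>t. \<epsilon> / 4 * j t) - integral {a..x} (\<lambda>t. \<epsilon> / 4 * j t)\<bar>"
      proof (rule abs_integral_diff_le[OF R _ x y(1)])
        show "(\<lambda>t. \<epsilon> / 4 * j t) integrable_on {a..b}" using j by (intro integrable_on_mult_right)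
        fix t assume "t \<in> closed_segment x y"
        then have t: "t \<in> {a..b}" "\<bar>t - x\<bar> \<le> \<bar>y - x\<bar>"
          using x y by (auto simp: closed_segment_eq_real_ivl split: if_splits)
        then have "\<bar>A t - A x\<bar> \<le> \<epsilon> / 4" "\<bar>B t - B x\<bar> \<le> \<epsilon> / 4"
          using d2[of t] d3[of t] y(2) by (auto simp: dist_real_def)
        then have "\<bar>A t - A x\<bar> * \<bar>p t\<bar> \<le> \<epsilon> / 4 * \<bar>p t\<bar>" "\<bar>B t - B x\<bar> * \<bar>q t\<bar> \<le> \<epsilon> / 4 * \<bar>q t\<bar>"
          by (simp_all only: mult_right_mono abs_ge_zero)
        then show "\<bar>R t\<bar> \<le> \<epsilon> / 4 * j t"
          using abs_triangle_ineq[of "(A t - A x) * p t" "(B t - B x) * q t"]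
          unfolding R_def j_def distrib_left abs_mult by linarith
      qed
      also have "\<dots> = \<bar>\<epsilon> / 4 * (J y - J x)\<bar>"
        by (simp only: J_def right_diff_distrib integral_mult_right)
      finally have 1: "\<bar>integral {a..y} R - integral {a..x} R\<bar> \<le> \<epsilon> / 4 * \<bar>J y - J x\<bar>"
        using \<open>\<epsilon> > 0\<close> by (simp only: abs_mult abs_of_pos)
      have R_eq: "integral {a..v} R = integral {a..v} h - A x * (P v - P a) - B x * (Q v - Q a)"
        if v: "v \<in> {a..b}" for v
      proof -
        have sub: "f integrable_on {a..v}" if "f integrable_on {a..b}" for f :: "real \<Rightarrow> real"
          by (rule integrable_on_subinterval[OF that]) (use v in auto)
        have "integral {a..v} R = integral {a..v} (\<lambda>t. h t - A x * p t - B x * q t)"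
          by (rule integral_cong) (simp add: R_def h_def algebra_simps)
        also have "\<dots> = integral {a..v} h - A x * integral {a..v} p - B x * integral {a..v} q"
          using sub[OF h] sub[OF p'(1)] sub[OF q'(1)]
          by (simp add: integral_diff integrable_diff integrable_on_mult_right)
        finally show ?thesis using P[OF v] Q[OF v] by simp
      qed
      have "\<bar>\<phi> (P y, Q y) - \<phi> (P x, Q x) - (A x * (P y - P x) + B x * (Q y - Q x))\<bar>
          \<le> \<epsilon> / 4 * norm ((P y, Q y) - (P x, Q x))"
        using d[of "(P y, Q y)"] d1[OF y(1)] y(2) by (simp add: dist_norm)
      also have "\<dots> \<le> \<epsilon> / 4 * (\<bar>P y - P x\<bar> + \<bar>Q y - Q x\<bar>)"
        using \<open>\<epsilon> > 0\<close> by (intro mult_left_mono) (auto simp: norm_Pair intro!: sqrt_sum_squares_le_sum_abs)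
      also have "\<dots> \<le> \<epsilon> / 4 * (\<bar>J y - J x\<bar> + \<bar>J y - J x\<bar>)"
        using \<open>\<epsilon> > 0\<close> by (intro mult_left_mono add_mono P_bound Q_bound) auto
      finally have 2: "\<bar>\<phi> (P y, Q y) - \<phi> (P x, Q x) - (A x * (P y - P x) + B x * (Q y - Q x))\<bar>
          \<le> \<epsilon> / 2 * \<bar>J y - J x\<bar>" by simp
      have "e y - e x = (\<phi> (P y, Q y) - \<phi> (P x, Q x) - (A x * (P y - P x) + B x * (Q y - Q x)))
            - (integral {a..y} R - integral {a..x} R)"
        by (simp add: e_def R_eq[OF x] R_eq[OF y(1)] algebra_simps)
      then have "\<bar>e y - e x\<bar> \<le> \<epsilon> / 2 * \<bar>J y - J x\<bar> + \<epsilon> / 4 * \<bar>J y - J x\<bar>"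
        using 1 2 by linarith
      also have "\<dots> \<le> \<epsilon> * \<bar>J y - J x\<bar>"
        using \<open>\<epsilon> > 0\<close> by (simp add: field_simps)
      finally show "\<bar>e y - e x\<bar> \<le> \<epsilon> * \<bar>J y - J x\<bar>" .
    qed
  qed
  ultimately have "e b = e a" by (rule eq_if_increments_dominated[OF \<open>a \<le> b\<close>])
  then show "integral {a..b} (\<lambda>x. A x * p x + B x * q x) = \<phi> (P b, Q b) - \<phi> (P a, Q a)"
    by (simp add: e_def h_def[abs_def])
qed

section \<open>Primitives on open intervals\<close>

text \<open>The interval is open at both ends, since a primitive such as the scale function may be infinite
  at the origin.\<close>

definition primitive_on :: "real \<Rightarrow> (real \<Rightarrow> real) \<Rightarrow> (real \<Rightarrow> real) \<Rightarrow> bool" where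
  "primitive_on r G g \<longleftrightarrow> (\<forall>u v. 0 < u \<longrightarrow> u \<le> v \<longrightarrow> v < r \<longrightarrow>
     g absolutely_integrable_on {u..v} \<and> integral {u..v} g = G v - G u)"

lemma primitive_onD:
  assumes "primitive_on r G g" "0 < u" "u \<le> v" "v < r"
  shows "g absolutely_integrable_on {u..v}" "g integrable_on {u..v}" "integral {u..v} g = G v - G u"
  using assms by (auto simp: primitive_on_def set_lebesgue_integral_eq_integral)

lemma primitive_on_eq:
  assumes "primitive_on r G g" "0 < u" "u \<le> x" "x < r"
  shows "G x = G u + integral {u..x} g"
  using primitive_onD(3)[OF assms] by simp

lemma primitive_on_has_derivative:
  assumes G: "primitive_on r G g" and "0 < u" "u < x" "x < r"
    and deriv: "((\<lambda>y. integral {u..y} g) has_real_derivative g x) (at x)"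
  shows "(G has_real_derivative g x) (at x)"
proof -
  have "((\<lambda>y. G u + integral {u..y} g) has_real_derivative g x) (at x)"
    using DERIV_add[OF DERIV_const deriv, of "G u"] by simp
  then show ?thesis
  proof (rule has_field_derivative_transform_within_open)
    show "open {u<..<r}" "x \<in> {u<..<r}" using assms by auto
    show "G u + integral {u..y} g = G y" if "y \<in> {u<..<r}" for y
      using primitive_on_eq[OF G \<open>0 < u\<close>, of y] that by simp
  qed
qed

lemma primitive_on_isCont_has_derivative:
  assumes G: "primitive_on r G g" and x: "0 < x" "x < r" and "isCont g x"
  shows "(G has_real_derivative g x) (at x)"
proof -
  define u v where "u = x / 2" and "v = (x + r) / 2"
  have uv: "0 < u" "u < x" "x < v" "v < r" using x by (auto simp: u_def v_def)
  have "((\<lambda>y. integral {u..y} g) has_vector_derivative g x) (at x within ({u..v} - {}))"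
    using uv primitive_onD(2)[OF G, of u v] \<open>isCont g x\<close>
    by (intro integral_has_vector_derivative_continuous_at) (auto intro: continuous_at_imp_continuous_at_within)
  then have "((\<lambda>y. integral {u..y} g) has_real_derivative g x) (at x within {u..v})"
    by (simp add: has_real_derivative_iff_has_vector_derivative)
  moreover have "at x within {u..v} = at x"
    by (rule at_within_Icc_at) (use uv in auto)
  ultimately show ?thesis
    using primitive_on_has_derivative[OF G] uv x by simp
qed

text \<open>The differentiation theorem on compact intervals exhausting \<open>{0<..<r}\<close>
  leaves a countable union of null sets.\<close>

lemma primitive_on_AE_has_derivative:
  assumes G: "primitive_on r G g"
  shows "negligible {x \<in> {0<..<r}. \<not> (G has_real_derivative g x) (at x)}"
proof -
  \<comment> \<open>As \<open>g\<close> may fail to be integrable up to the ends, each piece has its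
    own base point, which alters the indefinite integral only by a constant.\<close>
  define N where "N n = {x \<in> {inverse (real (Suc n))<..<r - inverse (real (Suc n))}.
      \<not> ((\<lambda>y. integral {inverse (real (Suc n))..y} g) has_real_derivative g x) (at x)}" for n
  have "negligible (N n)" for n
  proof (cases "inverse (real (Suc n)) \<le> r - inverse (real (Suc n))")
    case True
    then show ?thesis
      unfolding N_def
      by (intro has_real_derivative_indefinite_integral_AE primitive_onD(2)[OF G]) auto
  next
    case False
    then have "N n = {}" by (auto simp: N_def)
    then show ?thesis by simp
  qed
  then have "negligible (\<Union>n. N n)" by (intro negligible_countable_Union) auto
  then show ?thesis
  proof (rule negligible_subset, safe)
    fix x assume x: "x \<in> {0<..<r}" "\<not> (G has_real_derivative g x) (at x)"
    then have "min x (r - x) > 0" by simp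
    then obtain n where n: "inverse (real (Suc n)) < min x (r - x)"
      using reals_Archimedean by blast
    then have "x \<in> N n"
      using primitive_on_has_derivative[OF G, of "inverse (real (Suc n))" x] x by (auto simp: N_def)
    then show "x \<in> (\<Union>n. N n)" by blast
  qed
qed

lemma primitive_on_continuous:
  assumes G: "primitive_on r G g"
  shows "continuous_on {0<..<r} G"
proof (rule continuous_at_imp_continuous_on, safe)
  fix x assume "x \<in> {0<..<r}"
  then obtain u v where uv: "0 < u" "u < x" "x < v" "v < r"
    using dense[of 0 x] dense[of x r] by auto
  have "continuous_on {u..v} (\<lambda>y. G u + integral {u..y} g)"
    using uv primitive_onD(2)[OF G, of u v]
    by (intro continuous_intros indefinite_integral_continuous_1) auto
  then have "continuous_on {u..v} G"
    by (rule continuous_on_eq) (use uv in \<open>auto intro!: primitive_on_eq[OF G, symmetric]\<close>)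
  then show "isCont G x"
    using uv by (intro continuous_on_interior[of "{u..v}"]) (auto simp: interior_atLeastAtMost_real)
qed

text \<open>A function of two variables covers every combination needed: the product
  \<open>s F\<close>, its sum with \<open>H\<close>, and the exponential of the scale integral times
  \<open>F\<close>. \<open>A\<close> and \<open>B\<close> are the partial derivatives along the
  curve.\<close>

lemma primitive_on_chain_rule:
  assumes P: "primitive_on r P p" and Q: "primitive_on r Q q"
    and \<phi>: "\<And>x. x \<in> {0<..<r} \<Longrightarrow>
      (\<phi> has_derivative (\<lambda>h. A x * fst h + B x * snd h)) (at (P x, Q x))"
    and A: "continuous_on {0<..<r} A" and B: "continuous_on {0<..<r} B"
  shows "primitive_on r (\<lambda>x. \<phi> (P x, Q x)) (\<lambda>x. A x * p x + B x * q x)"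
  unfolding primitive_on_def
proof (intro allI impI)
  fix u v :: real assume uv: "0 < u" "u \<le> v" "v < r"
  then have sub: "{u..v} \<subseteq> {0<..<r}" by auto
  have u: "0 < x" "x < r" "x \<in> {0<..<r}" "u \<le> x" if "x \<in> {u..v}" for x
    using that uv by auto
  note * = integral_chain_rule[OF uv(2) primitive_onD(1)[OF P uv] primitive_onD(1)[OF Q uv]
      primitive_on_eq[OF P uv(1) u(4) u(2)] primitive_on_eq[OF Q uv(1) u(4) u(2)] \<phi>[OF u(3)]
      continuous_on_subset[OF A sub] continuous_on_subset[OF B sub]]
  show "(\<lambda>x. A x * p x + B x * q x) absolutely_integrable_on {u..v} \<and>
    integral {u..v} (\<lambda>x. A x * p x + B x * q x) = \<phi> (P v, Q v) - \<phi> (P u, Q u)"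
    using * by blast
qed

section \<open>From the first derivative to the differential equation\<close>

text \<open>By the chain rule \<open>V'\<close> is a primitive of \<open>h\<close>. Wherever
  \<open>I\<close> and \<open>F\<close> have derivatives \<open>k\<close> and \<open>f\<close>,
  \<open>h\<close> is \<open>V''\<close>; its first term cancels the drift \<open>b V'\<close> and
  its second one yields \<open>- c\<close>.\<close>

lemma solves_generator_odeI:
  assumes a_pos: "\<And>x. x > 0 \<Longrightarrow> a x > 0"
    and I: "primitive_on r I k" and F: "primitive_on r F f"
    and k: "\<And>x. x > 0 \<Longrightarrow> k x = 2 * b x / (a x)\<^sup>2"
    and f: "\<And>x. x > 0 \<Longrightarrow> f x = 2 * c x / ((a x)\<^sup>2 * exp (\<kappa> - I x))"
    and c: "continuous_on {0<..<r} c"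
    and V: "\<And>x. x \<in> {0<..<r} \<Longrightarrow> (V has_real_derivative - (exp (\<kappa> - I x) * F x)) (at x)"
  shows "solves_generator_ode a b c r V"
proof -
  define D where "D x = - (exp (\<kappa> - I x) * F x)" for x
  define h where "h x = exp (\<kappa> - I x) * F x * k x + (- exp (\<kappa> - I x)) * f x" for x
  note cont = primitive_on_continuous[OF I] primitive_on_continuous[OF F]
  have deriv_V: "deriv V x = D x" if "x \<in> {0<..<r}" for x
    using V[OF that] by (simp add: DERIV_imp_deriv D_def)
  have D: "primitive_on r D h"
    using primitive_on_chain_rule[OF I F, of "\<lambda>h. - (exp (\<kappa> - fst h) * snd h)"
        "\<lambda>x. exp (\<kappa> - I x) * F x" "\<lambda>x. - exp (\<kappa> - I x)"]
    by (force simp: D_def[abs_def] h_def[abs_def] intro!: continuous_intros cont derivative_eq_intros)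
  have ode: "(deriv V has_real_derivative h x) (at x)
      \<and> 1/2 * (a x)\<^sup>2 * h x + b x * deriv V x = - c x"
    if x: "x \<in> {0<..<r}" and "(I has_real_derivative k x) (at x)" "(F has_real_derivative f x) (at x)" for x
  proof
    have "(D has_real_derivative h x) (at x)"
      unfolding D_def[abs_def] h_def using that
      by (auto intro!: derivative_eq_intros simp: algebra_simps)
    then show "(deriv V has_real_derivative h x) (at x)"
      by (rule has_field_derivative_transform_within_open[of _ _ _ "{0<..<r}"]) (use x deriv_V in auto)
    show "1/2 * (a x)\<^sup>2 * h x + b x * deriv V x = - c x"
      using x a_pos[of x] by (simp add: deriv_V D_def h_def k f field_simps power2_eq_square)
  qed
  define N where "N = {x \<in> {0<..<r}. \<not> (I has_real_derivative k x) (at x)}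
    \<union> {x \<in> {0<..<r}. \<not> (F has_real_derivative f x) (at x)}"
  have N: "negligible N"
    unfolding N_def by (intro negligible_Un primitive_on_AE_has_derivative I F)
  have ode': "(deriv V has_real_derivative h x) (at x)
      \<and> 1/2 * (a x)\<^sup>2 * h x + b x * deriv V x = - c x" if "x \<in> {0<..<r} - N" for x
    using ode[of x] that by (auto simp: N_def)
  show ?thesis
    unfolding solves_generator_ode_def
  proof (intro conjI ballI allI impI)
    show "V differentiable at x" if "x \<in> {0<..<r}" for x
      using V[OF that] real_differentiable_def by blast
  next
    fix u v :: real assume uv: "0 < u" "u \<le> v" "v < r"
    \<comment> \<open>On \<open>N\<close> the second derivative may not exist and
      \<open>deriv\<close> may be an arbitrary value there, so the integrals are compared off
      \<open>N\<close> only.\<close>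
    have eq: "deriv (deriv V) x = h x" if "x \<in> {u..v} - N" for x
      using ode'[of x] that uv by (auto intro!: DERIV_imp_deriv)
    show "deriv (deriv V) absolutely_integrable_on {u..v}"
      by (rule absolutely_integrable_spike[OF primitive_onD(1)[OF D uv] N]) (use eq in auto)
    have "integral {u..v} (deriv (deriv V)) = integral {u..v} h"
      by (rule integral_spike[OF N]) (use eq in auto)
    then show "integral {u..v} (deriv (deriv V)) = deriv V v - deriv V u"
      using primitive_onD(3)[OF D uv] deriv_V uv by simp
  next
    have "AE x in lebesgue. x \<notin> N"
      using N by (simp add: negligible_iff_null_sets AE_not_in)
    then have "AE x in lborel. x \<notin> N" by (simp add: AE_completion_iff)
    then show "AE x in lborel. x \<in> {0<..<r} \<longrightarrow> deriv V differentiable at x \<and>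
        1/2 * (a x)\<^sup>2 * deriv (deriv V) x + b x * deriv V x = - c x"
      by eventually_elim (use ode' DERIV_imp_deriv real_differentiable_def in fastforce)
  next
    fix x assume x: "x \<in> {0<..<r}" and ab: "isCont a x" "isCont b x"
    have contI: "isCont I x" "isCont c x"
      using x cont(1) c by (auto simp: continuous_on_eq_continuous_at)
    \<comment> \<open>\<open>k\<close> and \<open>f\<close> are known only at positive arguments, so
      their continuity at \<open>x\<close> is transferred on a neighbourhood of
      \<open>x\<close>.\<close>
    have ev: "\<forall>\<^sub>F y in nhds x. y > 0"
      using x by (intro eventually_nhds_in_open[of "{0<..}", simplified]) auto
    have "a x \<noteq> 0" using a_pos[of x] x by simp
    then have "isCont (\<lambda>y. 2 * b y / (a y)\<^sup>2) x" "isCont (\<lambda>y. 2 * c y / ((a y)\<^sup>2 * exp (\<kappa> - I y))) x"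
      by (auto intro!: continuous_intros ab contI)
    moreover have "isCont k x \<longleftrightarrow> isCont (\<lambda>y. 2 * b y / (a y)\<^sup>2) x"
      by (rule isCont_cong) (use ev in \<open>eventually_elim, simp add: k\<close>)
    moreover have "isCont f x \<longleftrightarrow> isCont (\<lambda>y. 2 * c y / ((a y)\<^sup>2 * exp (\<kappa> - I y))) x"
      by (rule isCont_cong) (use ev in \<open>eventually_elim, simp add: f\<close>)
    ultimately have "(deriv V has_real_derivative h x) (at x)
      \<and> 1/2 * (a x)\<^sup>2 * h x + b x * deriv V x = - c x"
      using x by (intro ode primitive_on_isCont_has_derivative[OF I] primitive_on_isCont_has_derivative[OF F]) auto
    then show "deriv V differentiable at x"
      and "1/2 * (a x)\<^sup>2 * deriv (deriv V) x + b x * deriv V x = - c x"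
      by (auto simp: real_differentiable_def DERIV_imp_deriv)
  qed
qed

section \<open>Scale function and speed measure\<close>

text \<open>The coefficients are Borel on the positive half-line and arbitrary elsewhere; the
  indicator removes the uncontrolled values.\<close>

lemma set_borel_measurable_positive:
  fixes f :: "real \<Rightarrow> real"
  assumes "f \<in> borel_measurable (restrict_space borel {0<..})" "S \<in> sets borel" "S \<subseteq> {0<..}"
  shows "set_borel_measurable lborel S f"
proof -
  have "(\<lambda>x. indicator {0<..} x *\<^sub>R f x) \<in> borel_measurable borel"
    using assms(1) by (subst (asm) borel_measurable_restrict_space_iff) auto
  then have "(\<lambda>x. indicator S x *\<^sub>R (indicator {0<..} x *\<^sub>R f x)) \<in> borel_measurable borel"
    using assms(2) by measurable
  also have "(\<lambda>x. indicator S x *\<^sub>R (indicator {0<..} x *\<^sub>R f x)) = (\<lambda>x. indicator S x *\<^sub>R f x)"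
    using assms(3) by (auto simp: indicator_def fun_eq_iff)
  finally show ?thesis by (simp add: set_borel_measurable_def)
qed

lemma set_integrable_bounded_mult:
  fixes f g :: "'a \<Rightarrow> real"
  assumes g: "set_integrable M S g" and f: "set_borel_measurable M S f"
    and C: "\<And>x. x \<in> S \<Longrightarrow> \<bar>f x\<bar> \<le> C"
  shows "set_integrable M S (\<lambda>x. f x * g x)"
proof (rule set_integrable_bound)
  show "set_integrable M S (\<lambda>x. C * g x)" using g by simp
  have "(\<lambda>x. (indicator S x *\<^sub>R f x) * (indicator S x *\<^sub>R g x)) \<in> borel_measurable M"
    using g f by (auto simp: set_integrable_def set_borel_measurable_def)
  also have "(\<lambda>x. (indicator S x *\<^sub>R f x) * (indicator S x *\<^sub>R g x)) = (\<lambda>x. indicator S x *\<^sub>R (f x * g x))"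
    by (auto simp: indicator_def fun_eq_iff)
  finally show "set_borel_measurable M S (\<lambda>x. f x * g x)" by (simp add: set_borel_measurable_def)
  have "\<bar>f x * g x\<bar> \<le> \<bar>C * g x\<bar>" if "x \<in> S" for x
    unfolding abs_mult using C[OF that] by (intro mult_right_mono) auto
  then show "AE x in M. x \<in> S \<longrightarrow> norm (f x * g x) \<le> norm (C * g x)" by simp
qed

lemma set_integrable_continuous_mult:
  fixes f g :: "real \<Rightarrow> real"
  assumes g: "set_integrable lborel {u..v} g" and f: "continuous_on {0<..} f" and "0 < u"
  shows "set_integrable lborel {u..v} (\<lambda>x. f x * g x)"
proof -
  have "compact (f ` {u..v})"
    by (intro compact_continuous_image continuous_on_subset[OF f]) (use \<open>0 < u\<close> in auto)
  then obtain C where "\<forall>x\<in>{u..v}. \<bar>f x\<bar> \<le> C"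
    using compact_imp_bounded[of "f ` {u..v}"] by (auto simp: bounded_iff)
  then show ?thesis
    by (intro set_integrable_bounded_mult[OF g, of _ C] set_borel_measurable_positive
          borel_measurable_continuous_on_restrict f) (use \<open>0 < u\<close> in auto)
qed

lemma set_integrable_continuous:
  fixes f :: "real \<Rightarrow> real"
  assumes f: "continuous_on {0<..} f" and "0 < u"
  shows "set_integrable lborel {u..v} f"
  by (intro borel_integrable_atLeastAtMost' continuous_on_subset[OF f]) (use \<open>0 < u\<close> in auto)

text \<open>Translates finiteness of the extended-valued integral in \<open>origin_entrance\<close>
  into integrability.\<close>

lemma set_integrable_nonneg_iff:
  fixes f :: "'a \<Rightarrow> real"
  assumes "set_borel_measurable M S f" "\<And>x. x \<in> S \<Longrightarrow> 0 \<le> f x"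
  shows "set_integrable M S f \<longleftrightarrow> (\<integral>\<^sup>+ x\<in>S. ennreal (f x) \<partial>M) < \<infinity>"
proof -
  have "(\<integral>\<^sup>+ x. ennreal (norm (indicator S x *\<^sub>R f x)) \<partial>M) = (\<integral>\<^sup>+ x\<in>S. ennreal (f x) \<partial>M)"
    using assms(2) by (intro nn_integral_cong) (auto simp: indicator_def)
  then show ?thesis
    using assms(1) by (simp add: set_integrable_def set_borel_measurable_def integrable_iff_bounded)
qed

lemma nn_integral_eq_set_integral:
  fixes f :: "'a \<Rightarrow> real"
  assumes "set_integrable M S f" "\<And>x. x \<in> S \<Longrightarrow> 0 \<le> f x"
  shows "(\<integral>\<^sup>+ x\<in>S. ennreal (f x) \<partial>M) = ennreal (LINT x:S|M. f x)"
proof -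
  have "(\<integral>\<^sup>+ x\<in>S. ennreal (f x) \<partial>M) = (\<integral>\<^sup>+ x. ennreal (indicator S x *\<^sub>R f x) \<partial>M)"
    by (intro nn_integral_cong) (auto simp: indicator_def)
  also have "\<dots> = ennreal (LINT x|M. indicator S x *\<^sub>R f x)"
    using assms by (intro nn_integral_eq_integral) (auto simp: set_integrable_def indicator_def)
  finally show ?thesis by (simp add: set_lebesgue_integral_def)
qed

text \<open>Continuity from below of the measure with density \<open>g\<close>, along intervals
  increasing to \<open>{0<..p}\<close>.\<close>

lemma set_integrable_if_integrals_bounded:
  fixes g :: "real \<Rightarrow> real"
  assumes g: "\<And>x. 0 < x \<Longrightarrow> set_integrable lborel {x..p} g"
    and meas: "set_borel_measurable lborel {0<..p} g"
    and nonneg: "\<And>x. x \<in> {0<..p} \<Longrightarrow> 0 \<le> g x"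
    and B: "\<And>x. 0 < x \<Longrightarrow> x < p \<Longrightarrow> (LINT y:{x..p}|lborel. g y) \<le> B"
    and "0 < p"
  shows "set_integrable lborel {0<..p} g"
proof -
  define w where "w x = ennreal (indicator {0<..p} x *\<^sub>R g x)" for x
  define \<nu> where "\<nu> = density lborel w"
  \<comment> \<open>With 2 in the denominator the left end is below \<open>p\<close> already for
    \<open>n = 0\<close>, as the bound \<open>B\<close> requires.\<close>
  define A where "A n = {p / (real n + 2)..p}" for n
  have w: "w \<in> borel_measurable lborel"
    using meas by (simp add: w_def[abs_def] set_borel_measurable_def)
  have \<nu>: "emeasure \<nu> S = (\<integral>\<^sup>+ x\<in>S. ennreal (g x) \<partial>lborel)" if "S \<in> sets borel" "S \<subseteq> {0<..p}" for S
  proof -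
    have "emeasure \<nu> S = (\<integral>\<^sup>+ x. w x * indicator S x \<partial>lborel)"
      unfolding \<nu>_def by (rule emeasure_density[OF w]) (use that in simp)
    also have "\<dots> = (\<integral>\<^sup>+ x\<in>S. ennreal (g x) \<partial>lborel)"
      by (rule nn_integral_cong) (use that in \<open>auto simp: w_def indicator_def\<close>)
    finally show ?thesis .
  qed
  have A_sub: "A n \<subseteq> {0<..p}" for n
  proof -
    have "0 < p / (real n + 2)" using \<open>0 < p\<close> by simp
    then show ?thesis by (auto simp: A_def intro: less_le_trans)
  qed
  have "p / (real n + 2) \<le> p / (real k + 2)" if "k \<le> n" for k n
    using \<open>0 < p\<close> that by (intro divide_left_mono) auto
  then have "incseq A"
    by (force simp: A_def incseq_def)
  moreover have "range A \<subseteq> sets \<nu>"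
    by (auto simp: \<nu>_def A_def)
  moreover have "(\<Union>n. A n) = {0<..p}"
  proof (rule antisym[OF UN_least[OF A_sub]], rule subsetI)
    fix x assume x: "x \<in> {0<..p}"
    obtain n where "p / x < real n" using reals_Archimedean2 by blast
    then have "p / (real n + 2) \<le> x" using x by (simp add: field_simps add_increasing)
    then show "x \<in> (\<Union>n. A n)" using x by (auto simp: A_def)
  qed
  ultimately have "emeasure \<nu> {0<..p} = (SUP n. emeasure \<nu> (A n))"
    using SUP_emeasure_incseq[of A \<nu>] \<open>range A \<subseteq> sets \<nu>\<close> by simp
  also have "\<dots> \<le> ennreal B"
  proof (rule SUP_least)
    fix n
    have p: "0 < p / (real n + 2)" "p / (real n + 2) < p"
      using \<open>0 < p\<close> by (auto simp: field_simps add_pos_nonneg)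
    have "set_integrable lborel (A n) g" using g[OF p(1)] by (simp add: A_def)
    moreover have "0 \<le> g x" if "x \<in> A n" for x using nonneg A_sub that by blast
    ultimately have "(\<integral>\<^sup>+ x\<in>A n. ennreal (g x) \<partial>lborel) = ennreal (LINT y:A n|lborel. g y)"
      by (rule nn_integral_eq_set_integral)
    moreover have "emeasure \<nu> (A n) = (\<integral>\<^sup>+ x\<in>A n. ennreal (g x) \<partial>lborel)"
      by (rule \<nu>[OF _ A_sub]) (simp add: A_def)
    ultimately have "emeasure \<nu> (A n) = ennreal (LINT y:A n|lborel. g y)" by simp
    also have "\<dots> \<le> ennreal B"
      using B[OF p] by (intro ennreal_leI) (simp add: A_def)
    finally show "emeasure \<nu> (A n) \<le> ennreal B" .
  qed
  finally have "emeasure \<nu> {0<..p} < \<infinity>"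
    using ennreal_less_top[of B] by (auto simp: top.not_eq_extremum elim: le_less_trans)
  then show ?thesis
    using \<nu>[of "{0<..p}"] by (subst set_integrable_nonneg_iff[OF meas]) (simp_all add: nonneg)
qed

section \<open>Primitives given by Lebesgue and interval integrals\<close>

lemma primitive_onI:
  assumes g: "\<And>u v. 0 < u \<Longrightarrow> u \<le> v \<Longrightarrow> v < r \<Longrightarrow> set_integrable lborel {u..v} g"
    and G: "\<And>u v. 0 < u \<Longrightarrow> u \<le> v \<Longrightarrow> v < r \<Longrightarrow> G v - G u = (LINT x:{u..v}|lborel. g x)"
  shows "primitive_on r G g"
  unfolding primitive_on_def
proof (intro allI impI conjI)
  fix u v :: real assume uv: "0 < u" "u \<le> v" "v < r"
  show "g absolutely_integrable_on {u..v}"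
    using g[OF uv] unfolding set_integrable_def
    by (subst integrable_completion) (auto dest: borel_measurable_integrable)
  show "integral {u..v} g = G v - G u"
    using set_borel_integral_eq_integral(2)[OF g[OF uv]] G[OF uv] by simp
qed

lemma primitive_on_interval_integral:
  fixes g :: "real \<Rightarrow> real"
  assumes g: "\<And>u v. 0 < u \<Longrightarrow> set_integrable lborel {u..v} g"
  shows "primitive_on r (\<lambda>x. C + (LBINT y=ereal 1..ereal x. g y)) g"
proof (rule primitive_onI)
  fix u v :: real assume uv: "0 < u" "u \<le> v"
  have "(LBINT y=ereal 1..ereal u. g y) + (LBINT y=ereal u..ereal v. g y) = (LBINT y=ereal 1..ereal v. g y)"
  proof (rule interval_integral_sum)
    \<comment> \<open>The base point 1 may lie on either side of \<open>u\<close> and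
      \<open>v\<close>; integrability on the hull of all three points covers every order.\<close>
    define p q where "p = min 1 (min u v)" and "q = max 1 (max u v)"
    have "p > 0" "p \<le> q" using uv by (auto simp: p_def q_def)
    then have "set_integrable lborel {p<..<q} g"
      by (intro set_integrable_subset[OF g[of p q]]) auto
    then have "interval_lebesgue_integrable lborel (ereal p) (ereal q) g"
      using \<open>p \<le> q\<close> by (simp add: interval_lebesgue_integrable_def)
    then show "interval_lebesgue_integrable lborel (min (ereal 1) (min (ereal u) (ereal v)))
        (max (ereal 1) (max (ereal u) (ereal v))) g"
      by (simp only: p_def q_def ereal_min ereal_max)
  qed
  moreover have "(LBINT y=ereal u..ereal v. g y) = (LINT y:{u..v}|lborel. g y)"
    using uv by (simp add: interval_integral_Icc)
  ultimately show "C + (LBINT y=ereal 1..ereal v. g y) - (C + (LBINT y=ereal 1..ereal u. g y))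
      = (LINT y:{u..v}|lborel. g y)" by simp
qed (use g in auto)

lemma primitive_on_continuous_positive:
  assumes "\<And>r. primitive_on r G g"
  shows "continuous_on {0<..} G"
proof (rule continuous_at_imp_continuous_on, rule ballI)
  fix x :: real assume "x \<in> {0<..}"
  then show "isCont G x"
    using primitive_on_continuous[OF assms[of "x + 1"]] by (simp add: continuous_on_eq_continuous_at)
qed

section \<open>The scale function, its derivative and the speed density\<close>

locale diffusion_coefficients =
  fixes a b :: "real \<Rightarrow> real" and \<kappa> K :: real
  assumes a_borel: "a \<in> borel_measurable (restrict_space borel {0<..})"
    and b_borel: "b \<in> borel_measurable (restrict_space borel {0<..})"
    and a_pos: "\<And>x. x > 0 \<Longrightarrow> a x > 0"
    and loc_int: "locally_integrable_coeffs a b"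
begin

abbreviation s :: "real \<Rightarrow> real" where "s \<equiv> scale_fun a b \<kappa> K"
abbreviation m :: "real measure" where "m \<equiv> speed_measure a s"

definition I :: "real \<Rightarrow> real" where "I x = (LBINT \<xi>=ereal 1..ereal x. 2 * b \<xi> / (a \<xi>)\<^sup>2)"
text \<open>An explicit continuous stand-in for \<open>deriv s\<close>, identified with it on the
  positive half-line by \<open>s_has_derivative\<close>; then \<rho> is the density inside
  \<open>speed_measure\<close>.\<close>

definition s' :: "real \<Rightarrow> real" where "s' x = exp (\<kappa> - I x)"
definition \<rho> :: "real \<Rightarrow> real" where "\<rho> x = 2 / ((a x)\<^sup>2 * s' x)"

text \<open>Integrability near each point passes to compact intervals by bisection, since it is
  inherited by unions of adjacent intervals.\<close>

lemma set_integrable_coeffs: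
  assumes "0 < u"
  shows "set_integrable lborel {u..v} (\<lambda>y. (1 + \<bar>b y\<bar>) / (a y)\<^sup>2)"
proof (cases "u \<le> v")
  case True
  define P where "P x y \<longleftrightarrow> (u \<le> x \<longrightarrow> x \<le> y \<longrightarrow> set_integrable lborel {x..y} (\<lambda>y. (1 + \<bar>b y\<bar>) / (a y)\<^sup>2))" for x y
  have "P u v"
    using True
  proof (rule Bolzano)
    fix x y z assume xyz: "P x y" "P y z" "x \<le> y" "y \<le> z"
    then have "{x..y} \<union> {y..z} = {x..z}" by auto
    then show "P x z"
      using xyz set_integrable_Un[of lborel "{x..y}" _ "{y..z}"] by (auto simp: P_def)
  next
    fix x assume "u \<le> x"
    with \<open>0 < u\<close> have "x > 0" by simp
    then obtain \<epsilon> where "0 < \<epsilon>" and \<epsilon>: "set_integrable lborel {x - \<epsilon>..x + \<epsilon>} (\<lambda>y. (1 + \<bar>b y\<bar>) / (a y)\<^sup>2)"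
      using loc_int unfolding locally_integrable_coeffs_def by blast
    have "P y z" if "y \<le> x" "x \<le> z" "z - y < \<epsilon>" for y z
      unfolding P_def by (intro impI set_integrable_subset[OF \<epsilon>]) (use that in auto)
    then show "\<exists>d>0. \<forall>y z. y \<le> x \<and> x \<le> z \<and> z - y < d \<longrightarrow> P y z"
      using \<open>0 < \<epsilon>\<close> by blast
  qed
  then show ?thesis using True by (simp add: P_def)
next
  case False
  then show ?thesis by (simp add: set_integrable_def)
qed

lemma set_integrable_coeff_bound:
  assumes g: "g \<in> borel_measurable (restrict_space borel {0<..})" and "0 < u"
    and le: "\<And>x. x > 0 \<Longrightarrow> \<bar>g x\<bar> \<le> C * ((1 + \<bar>b x\<bar>) / (a x)\<^sup>2)"
  shows "set_integrable lborel {u..v} g"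
proof (rule set_integrable_bound)
  show "set_integrable lborel {u..v} (\<lambda>y. C * ((1 + \<bar>b y\<bar>) / (a y)\<^sup>2))"
    by (intro set_integrable_mult_right set_integrable_coeffs \<open>0 < u\<close>)
  show "set_borel_measurable lborel {u..v} g"
    by (rule set_borel_measurable_positive[OF g]) (use \<open>0 < u\<close> in auto)
  have "\<bar>g x\<bar> \<le> \<bar>C * ((1 + \<bar>b x\<bar>) / (a x)\<^sup>2)\<bar>" if "x \<in> {u..v}" for x
    by (rule order_trans[OF le abs_ge_self]) (use that \<open>0 < u\<close> in auto)
  then show "AE x in lborel. x \<in> {u..v} \<longrightarrow> norm (g x) \<le> norm (C * ((1 + \<bar>b x\<bar>) / (a x)\<^sup>2))"
    by simp
qed

lemma primitive_I: "primitive_on r I (\<lambda>x. 2 * b x / (a x)\<^sup>2)"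
proof -
  have "set_integrable lborel {u..v} (\<lambda>x. 2 * b x / (a x)\<^sup>2)" if "0 < u" for u v
  proof (rule set_integrable_coeff_bound[OF _ that])
    show "(\<lambda>x. 2 * b x / (a x)\<^sup>2) \<in> borel_measurable (restrict_space borel {0<..})"
      using a_borel b_borel by measurable
    show "\<bar>2 * b x / (a x)\<^sup>2\<bar> \<le> 2 * ((1 + \<bar>b x\<bar>) / (a x)\<^sup>2)" if "x > 0" for x
      using a_pos[OF that] by (simp add: abs_mult divide_right_mono)
  qed
  from primitive_on_interval_integral[OF this, of r 0] show ?thesis by (simp add: I_def[abs_def])
qed

lemma continuous_s': "continuous_on {0<..} s'"
  unfolding s'_def[abs_def]
  by (intro continuous_intros primitive_on_continuous_positive[OF primitive_I])

lemma s'_pos: "s' x > 0"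
  by (simp add: s'_def)

lemma primitive_s: "primitive_on r s s'"
  using primitive_on_interval_integral[OF set_integrable_continuous[OF continuous_s'], of r K]
  by (simp add: scale_fun_def[abs_def] s'_def[abs_def] I_def)

lemma s_has_derivative:
  assumes "x > 0"
  shows "(s has_real_derivative s' x) (at x)"
  using primitive_on_isCont_has_derivative[OF primitive_s[of "x + 1"]] continuous_s' assms
  by (simp add: continuous_on_eq_continuous_at)

lemma continuous_s: "continuous_on {0<..} s"
  by (rule primitive_on_continuous_positive[OF primitive_s])

lemma s_strict_mono:
  assumes "0 < x" "x < y"
  shows "s x < s y"
  by (rule DERIV_pos_imp_increasing[OF \<open>x < y\<close>])
     (use assms s_has_derivative s'_pos in \<open>meson less_le_trans\<close>)

lemma \<rho>_nonneg: "\<rho> x \<ge> 0"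
  using s'_pos[of x] by (simp add: \<rho>_def)

lemma \<rho>_borel: "\<rho> \<in> borel_measurable (restrict_space borel {0<..})"
  unfolding \<rho>_def[abs_def]
  using a_borel borel_measurable_continuous_on_restrict[OF continuous_s'] by measurable

lemma set_integrable_\<rho>:
  assumes "0 < u"
  shows "set_integrable lborel {u..v} \<rho>"
proof -
  have "set_integrable lborel {u..v} (\<lambda>x. 1 / (a x)\<^sup>2)"
  proof (rule set_integrable_coeff_bound[OF _ assms])
    show "(\<lambda>x. 1 / (a x)\<^sup>2) \<in> borel_measurable (restrict_space borel {0<..})"
      using a_borel by measurable
    show "\<bar>1 / (a x)\<^sup>2\<bar> \<le> 1 * ((1 + \<bar>b x\<bar>) / (a x)\<^sup>2)" if "x > 0" for x
      using a_pos[OF that] by (simp add: divide_right_mono)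
  qed
  moreover have "continuous_on {0<..} (\<lambda>x. 2 / s' x)"
    using s'_pos by (intro continuous_intros continuous_s') (auto simp: less_imp_neq[THEN not_sym])
  ultimately have "set_integrable lborel {u..v} (\<lambda>x. 2 / s' x * (1 / (a x)\<^sup>2))"
    by (rule set_integrable_continuous_mult[OF _ _ assms])
  then show ?thesis by (simp add: \<rho>_def[abs_def] mult.commute)
qed

lemma speed_measure_eq: "m = density lborel (\<lambda>x. ennreal (indicator {0<..} x * \<rho> x))"
  unfolding speed_measure_def
  by (intro arg_cong[where f = "density lborel"] ext)
     (auto simp: indicator_def \<rho>_def DERIV_imp_deriv[OF s_has_derivative])

lemma \<rho>_ind_borel: "(\<lambda>x. indicator {0<..} x * \<rho> x) \<in> borel_measurable lborel"
  using set_borel_measurable_positive[OF \<rho>_borel, of "{0<..}"] by (simp add: set_borel_measurable_def)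

lemma LINT_speed:
  fixes g :: "real \<Rightarrow> real"
  assumes g: "g \<in> borel_measurable (restrict_space borel {0<..})" and S: "S \<in> sets borel" "S \<subseteq> {0<..}"
  shows "(LINT x:S|m. g x) = (LINT x:S|lborel. g x * \<rho> x)"
proof -
  have "(\<lambda>x. indicator S x *\<^sub>R g x) \<in> borel_measurable lborel"
    using set_borel_measurable_positive[OF g S] by (simp add: set_borel_measurable_def)
  then have "(LINT x:S|m. g x) = (LINT x|lborel. (indicator {0<..} x * \<rho> x) *\<^sub>R (indicator S x *\<^sub>R g x))"
    unfolding speed_measure_eq set_lebesgue_integral_def
    by (rule integral_density[OF _ \<rho>_ind_borel]) (auto simp: \<rho>_nonneg)
  also have "\<dots> = (LINT x:S|lborel. g x * \<rho> x)"
    unfolding set_lebesgue_integral_def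
    by (rule Bochner_Integration.integral_cong) (use S(2) in \<open>auto simp: indicator_def\<close>)
  finally show ?thesis .
qed

lemma nn_integral_speed:
  fixes g :: "real \<Rightarrow> real"
  assumes g: "g \<in> borel_measurable (restrict_space borel {0<..})" and S: "S \<in> sets borel" "S \<subseteq> {0<..}"
  shows "(\<integral>\<^sup>+ x\<in>S. ennreal (g x) \<partial>m) = (\<integral>\<^sup>+ x\<in>S. ennreal (g x * \<rho> x) \<partial>lborel)"
proof -
  have "(\<lambda>x. ennreal (indicator S x *\<^sub>R g x)) \<in> borel_measurable lborel"
    using set_borel_measurable_positive[OF g S] by (simp add: set_borel_measurable_def)
  also have "(\<lambda>x. ennreal (indicator S x *\<^sub>R g x)) = (\<lambda>x. ennreal (g x) * indicator S x)"
    by (auto simp: indicator_def fun_eq_iff)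
  finally have "(\<integral>\<^sup>+ x\<in>S. ennreal (g x) \<partial>m)
      = (\<integral>\<^sup>+ x. ennreal (indicator {0<..} x * \<rho> x) * (ennreal (g x) * indicator S x) \<partial>lborel)"
    unfolding speed_measure_eq by (intro nn_integral_density) (use \<rho>_ind_borel in simp_all)
  also have "\<dots> = (\<integral>\<^sup>+ x\<in>S. ennreal (g x * \<rho> x) \<partial>lborel)"
    by (rule nn_integral_cong)
       (use S(2) in \<open>auto simp: indicator_def ennreal_mult'[OF \<rho>_nonneg] ennreal_mult''[OF \<rho>_nonneg] mult.commute\<close>)
  finally show ?thesis .
qed

end

section \<open>The boundary value problem\<close>

text \<open>Reduces the boundary condition at the origin to the question whether an infimum is
  \<open>-\<infinity>\<close>.\<close>

lemma filterlim_at_right_INF: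
  fixes V :: "real \<Rightarrow> real"
  assumes mono: "\<And>u v. l < u \<Longrightarrow> u \<le> v \<Longrightarrow> v < p \<Longrightarrow> V u \<le> V v" and "l < p"
  shows "((\<lambda>x. ereal (V x)) \<longlongrightarrow> (INF x\<in>{l<..<p}. ereal (V x))) (at_right l)"
proof (rule order_tendstoI)
  have ev: "\<forall>\<^sub>F x in at_right l. x \<in> {l<..<q}" if "l < q" for q
    using that by (rule eventually_at_right_real)
  fix y
  {
    assume y: "y < (INF x\<in>{l<..<p}. ereal (V x))"
    show "\<forall>\<^sub>F x in at_right l. y < ereal (V x)"
      using ev[OF \<open>l < p\<close>] by eventually_elim (use y in \<open>auto elim: less_INF_D\<close>)
  next
    assume "(INF x\<in>{l<..<p}. ereal (V x)) < y"
    then obtain q where q: "q \<in> {l<..<p}" "ereal (V q) < y"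
      by (auto simp: INF_less_iff)
    have "\<forall>\<^sub>F x in at_right l. x \<in> {l<..<q}" using q by (intro ev) simp
    then show "\<forall>\<^sub>F x in at_right l. ereal (V x) < y"
    proof eventually_elim
      case (elim x)
      then have "V x \<le> V q" using mono[of x q] q by simp
      then show ?case using q by (meson ereal_less_eq(3) le_less_trans)
    qed
  }
qed

lemma primitive_on_cong:
  assumes "primitive_on R G g" "\<And>x. x \<in> {0<..<R} \<Longrightarrow> H x = G x + C" "\<And>x. x \<in> {0<..<R} \<Longrightarrow> h x = g x"
  shows "primitive_on R H h"
  unfolding primitive_on_def
proof (intro allI impI conjI)
  fix u v :: real assume uv: "0 < u" "u \<le> v" "v < R"
  have eq: "h x = g x" if "x \<in> {u..v}" for x using assms(3)[of x] that uv by auto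
  show "h absolutely_integrable_on {u..v}"
    using primitive_onD(1)[OF assms(1) uv]
    by (rule absolutely_integrable_spike[where S = "{}"]) (use eq in auto)
  have "integral {u..v} h = integral {u..v} g" using eq by (intro integral_cong)
  then show "integral {u..v} h = H v - H u"
    using primitive_onD(3)[OF assms(1) uv] assms(2)[of u] assms(2)[of v] uv by simp
qed

section \<open>The cost function and its primitives\<close>

locale transient_diffusion = diffusion_coefficients +
  fixes z r :: real
  assumes s_inf: "(scale_fun a b \<kappa> K \<longlongrightarrow> 0) at_top"
    and m_fin: "emeasure (speed_measure a (scale_fun a b \<kappa> K)) {0<..1} < \<infinity>"
    and z_pos: "z > 0"
    and r_pos: "r > 0"
    and r_zero: "(LINT y:{0<..r}|speed_measure a (scale_fun a b \<kappa> K). cost (scale_fun a b \<kappa> K) z y) = 0"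
begin

abbreviation c :: "real \<Rightarrow> real" where "c \<equiv> cost s z"
abbreviation V :: "real \<Rightarrow> real" where "V \<equiv> Vtilde s m c r"

definition f :: "real \<Rightarrow> real" where "f x = c x * \<rho> x"
definition F :: "real \<Rightarrow> real" where "F x = (LINT y:{0<..x}|lborel. f y)"
text \<open>Based at 1, as \<open>s f\<close> need not be integrable at the origin; the base point
  drops out of \<open>H x - H r\<close>.\<close>

definition H :: "real \<Rightarrow> real" where "H x = (LBINT y=ereal 1..ereal x. s y * f y)"
text \<open>Up to \<open>p\<close> the cost is -1, \<open>V\<close> is given by its integral
  formula, and one stays inside the interval used in the boundary classification.\<close>

definition p :: real where "p = min 1 (min z r)"

text \<open>\<open>s\<close> increases to its limit 0, so \<open>s (x + 1)\<close> is at most 0; the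
  step from \<open>x\<close> to \<open>x + 1\<close> makes the inequality strict.\<close>

lemma s_neg:
  assumes "x > 0"
  shows "s x < 0"
proof -
  have "s (x + 1) \<le> 0"
  proof (rule tendsto_lowerbound[OF s_inf])
    have "s (x + 1) \<le> s y" if "y \<ge> x + 1" for y
      using s_strict_mono[of "x + 1" y] that assms by (cases "y = x + 1") auto
    then show "\<forall>\<^sub>F y in at_top. s (x + 1) \<le> s y"
      by (rule eventually_mono[OF eventually_ge_at_top])
  qed simp
  then show ?thesis using s_strict_mono[of x "x + 1"] assms by simp
qed

text \<open>As \<open>s z\<close> is negative, dividing by it reverses the order, so the quotient is
  at least 1 to the left of \<open>z\<close> and the minimum cuts it off.\<close>

lemma c_eq:
  assumes "0 < x" "x \<le> z"
  shows "c x = -1"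
proof -
  have "s x \<le> s z" using s_strict_mono[of x z] assms by (cases "x = z") auto
  then have "s x / s z \<ge> 1" using s_neg[OF z_pos] by (simp add: le_divide_eq)
  then show ?thesis by (simp add: cost_def min_def)
qed

lemma c_bound:
  assumes "0 < x"
  shows "\<bar>c x\<bar> \<le> 1"
proof -
  have "s x / s z > 0" using s_neg[OF assms] s_neg[OF z_pos] by (simp add: divide_neg_neg)
  then show ?thesis by (auto simp: cost_def min_def abs_if)
qed

lemma continuous_c: "continuous_on {0<..} c"
  unfolding cost_def[abs_def] using s_neg[OF z_pos]
  by (intro continuous_intros continuous_on_min continuous_s) auto

lemma borel_continuous:
  fixes g :: "real \<Rightarrow> real"
  shows "continuous_on {0<..} g \<Longrightarrow> g \<in> borel_measurable (restrict_space borel {0<..})"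
  by (rule borel_measurable_continuous_on_restrict)

lemma set_integrable_\<rho>_0: "set_integrable lborel {0<..x} \<rho>"
proof -
  have "(\<integral>\<^sup>+ y\<in>{0<..1}. ennreal (1 * \<rho> y) \<partial>lborel) = (\<integral>\<^sup>+ y\<in>{0<..1}. ennreal 1 \<partial>m)"
    by (rule nn_integral_speed[symmetric]) auto
  also have "\<dots> = emeasure m {0<..1}"
    by (simp add: speed_measure_def)
  finally have "(\<integral>\<^sup>+ y\<in>{0<..1}. ennreal (\<rho> y) \<partial>lborel) < \<infinity>"
    using m_fin by simp
  then have "set_integrable lborel {0<..1} \<rho>"
    by (subst set_integrable_nonneg_iff) (auto intro: set_borel_measurable_positive \<rho>_borel \<rho>_nonneg)
  \<comment> \<open>For \<open>x < 1\<close> the second set is empty and the passage to a subset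
    does the rest.\<close>
  then have "set_integrable lborel ({0<..1} \<union> {1..x}) \<rho>"
    by (rule set_integrable_Un) (auto intro: set_integrable_\<rho>)
  then show ?thesis by (rule set_integrable_subset) auto
qed

text \<open>A bounded cost against a speed density of finite mass at the origin: \<open>F\<close> is
  a genuine integral from 0, and the equation \<open>r_zero\<close> cannot stem from the default
  value 0 of a divergent integral.\<close>

lemma set_integrable_f_0: "set_integrable lborel {0<..x} f"
  unfolding f_def[abs_def]
  by (rule set_integrable_bounded_mult[OF set_integrable_\<rho>_0 _ c_bound])
     (auto intro!: set_borel_measurable_positive borel_continuous continuous_c)

lemma set_integrable_f:
  assumes "0 < u"
  shows "set_integrable lborel {u..v} f"
  by (rule set_integrable_subset[OF set_integrable_f_0[of v]]) (use assms in auto)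

lemma set_integrable_sf:
  assumes "0 < u"
  shows "set_integrable lborel {u..v} (\<lambda>y. s y * f y)"
  by (rule set_integrable_continuous_mult[OF set_integrable_f continuous_s]) (use assms in auto)

lemma primitive_F: "primitive_on R F f"
proof (rule primitive_onI)
  fix u v :: real assume uv: "0 < u" "u \<le> v"
  \<comment> \<open>The two pieces share the point \<open>u\<close>, a null set.\<close>
  then have "{0<..v} = {0<..u} \<union> {u..v}" by auto
  moreover have "AE x in lborel. \<not> (x \<in> {0<..u} \<and> x \<in> {u..v})"
    using AE_lborel_singleton[of u] by eventually_elim auto
  ultimately have "F v = F u + (LINT x:{u..v}|lborel. f x)"
    unfolding F_def
    by (simp only:) (rule set_integral_Un_AE; use uv in \<open>simp add: set_integrable_f_0 set_integrable_f\<close>)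
  then show "F v - F u = (LINT x:{u..v}|lborel. f x)" by simp
qed (rule set_integrable_f)

lemma primitive_H: "primitive_on R H (\<lambda>x. s x * f x)"
  using primitive_on_interval_integral[OF set_integrable_sf, of R 0] by (simp add: H_def[abs_def])

lemma F_r: "F r = 0"
proof -
  have "F r = (LINT y:{0<..r}|m. c y)"
    unfolding F_def f_def by (rule LINT_speed[OF borel_continuous[OF continuous_c], symmetric]) auto
  then show ?thesis using r_zero by simp
qed

section \<open>The first derivative of \<open>V\<close> and the equation\<close>

lemma V_eq:
  assumes "0 < x" "x \<le> r"
  shows "V x = - (s x * F x) + H x - H r"
proof -
  have "(LINT y:{0<..x}|m. s x * c y) = s x * (LINT y:{0<..x}|m. c y)"
    by simp
  also have "(LINT y:{0<..x}|m. c y) = F x"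
    unfolding F_def f_def by (rule LINT_speed[OF borel_continuous[OF continuous_c]]) auto
  finally have 1: "(LINT y:{0<..x}|m. s x * c y) = s x * F x" .
  have "(LINT y:{x..r}|m. s y * c y) = (LINT y:{x..r}|lborel. s y * c y * \<rho> y)"
    by (rule LINT_speed)
       (use assms in \<open>auto intro!: borel_continuous continuous_intros continuous_s continuous_c\<close>)
  also have "\<dots> = integral {x..r} (\<lambda>y. s y * f y)"
    using set_borel_integral_eq_integral(2)[OF set_integrable_sf[OF assms(1)], of r]
    by (simp add: f_def mult.assoc)
  also have "\<dots> = H r - H x"
    by (rule primitive_onD(3)[OF primitive_H[of "r + 1"]]) (use assms in auto)
  finally show ?thesis using assms 1 by (simp add: Vtilde_def)
qed

text \<open>The product rule for \<open>- s F\<close> produces the term \<open>- s f\<close>, which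
  the derivative \<open>s f\<close> of \<open>H\<close> cancels. What remains is continuous, so
  \<open>V\<close> is continuously differentiable although \<open>f\<close> is only
  measurable.\<close>

lemma primitive_V: "primitive_on r V (\<lambda>x. - (s' x * F x))"
proof -
  have cont: "continuous_on {0<..<r} s" "continuous_on {0<..<r} F"
    by (rule primitive_on_continuous[OF primitive_s] primitive_on_continuous[OF primitive_F])+
  have "primitive_on r (\<lambda>x. - (s x * F x)) (\<lambda>x. - F x * s' x + - s x * f x)"
    using primitive_on_chain_rule[OF primitive_s primitive_F,
        of r "\<lambda>h. - (fst h * snd h)" "\<lambda>x. - F x" "\<lambda>x. - s x"]
    by (force intro!: continuous_intros cont derivative_eq_intros)
  from primitive_on_chain_rule[OF this primitive_H, of "\<lambda>h. fst h + snd h" "\<lambda>_. 1" "\<lambda>_. 1"]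
  have "primitive_on r (\<lambda>x. - (s x * F x) + H x) (\<lambda>x. 1 * (- F x * s' x + - s x * f x) + 1 * (s x * f x))"
    by (force intro!: continuous_intros derivative_eq_intros)
  then show ?thesis
    by (rule primitive_on_cong[where C = "- H r"]) (auto simp: V_eq algebra_simps)
qed

lemma V_has_derivative:
  assumes "x \<in> {0<..<r}"
  shows "(V has_real_derivative - (s' x * F x)) (at x)"
proof (rule primitive_on_isCont_has_derivative[OF primitive_V])
  have "continuous_on {0<..} (\<lambda>x. - (s' x * F x))"
    by (intro continuous_intros continuous_s' primitive_on_continuous_positive[OF primitive_F])
  then show "isCont (\<lambda>x. - (s' x * F x)) x"
    using assms by (simp add: continuous_on_eq_continuous_at)
qed (use assms in auto)

lemma solves_generator_ode_V: "solves_generator_ode a b c r V"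
proof (rule solves_generator_odeI[OF a_pos primitive_I primitive_F])
  show "f x = 2 * c x / ((a x)\<^sup>2 * exp (\<kappa> - I x))" for x
    by (simp add: f_def \<rho>_def s'_def)
  show "continuous_on {0<..<r} c"
    by (rule continuous_on_subset[OF continuous_c]) auto
  show "(V has_real_derivative - (exp (\<kappa> - I x) * F x)) (at x)" if "x \<in> {0<..<r}" for x
    using V_has_derivative[OF that] by (simp add: s'_def)
qed simp_all

section \<open>Boundary conditions at \<open>r\<close>\<close>

lemma eventually_at_left_r: "\<forall>\<^sub>F x in at_left r. x \<in> {0<..<r}"
  using r_pos by (rule eventually_at_left_real)

text \<open>All ingredients of \<open>V\<close> and \<open>V'\<close> are continuous across
  \<open>r\<close>, so the left limits are values at \<open>r\<close>, where \<open>F\<close>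
  vanishes.\<close>

lemma
  shows isCont_s'_r: "isCont s' r" and isCont_s_r: "isCont s r"
    and isCont_F_r: "isCont F r" and isCont_H_r: "isCont H r"
  using r_pos continuous_s' continuous_s primitive_on_continuous_positive[OF primitive_F]
    primitive_on_continuous_positive[OF primitive_H]
  by (simp_all add: continuous_on_eq_continuous_at)

lemmas tendsto_at_left_r = isContD[THEN tendsto_within_subset, OF _ subset_UNIV]

lemma V_at_left_r: "(V \<longlongrightarrow> 0) (at_left r)"
proof -
  have "((\<lambda>x. - (s x * F x) + H x - H r) \<longlongrightarrow> - (s r * F r) + H r - H r) (at_left r)"
    by (intro tendsto_intros tendsto_at_left_r isCont_s_r isCont_F_r isCont_H_r)
  then have "((\<lambda>x. - (s x * F x) + H x - H r) \<longlongrightarrow> 0) (at_left r)"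
    by (simp add: F_r)
  moreover have "\<forall>\<^sub>F x in at_left r. - (s x * F x) + H x - H r = V x"
    using eventually_at_left_r by eventually_elim (simp add: V_eq)
  ultimately show ?thesis by (rule Lim_transform_eventually)
qed

lemma deriv_V_at_left_r: "(deriv V \<longlongrightarrow> 0) (at_left r)"
proof -
  have "((\<lambda>x. - (s' x * F x)) \<longlongrightarrow> - (s' r * F r)) (at_left r)"
    by (intro tendsto_intros tendsto_at_left_r isCont_s'_r isCont_F_r)
  then have "((\<lambda>x. - (s' x * F x)) \<longlongrightarrow> 0) (at_left r)"
    by (simp add: F_r)
  moreover have "\<forall>\<^sub>F x in at_left r. - (s' x * F x) = deriv V x"
    using eventually_at_left_r by eventually_elim (simp add: DERIV_imp_deriv[OF V_has_derivative])
  ultimately show ?thesis by (rule Lim_transform_eventually)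
qed

section \<open>Boundary behaviour at the origin\<close>

lemma p: "0 < p" "p \<le> 1" "p \<le> z" "p \<le> r"
  using z_pos r_pos by (auto simp: p_def)

lemma F_eq:
  assumes "0 < x" "x \<le> z"
  shows "F x = - (LINT y:{0<..x}|lborel. \<rho> y)"
proof -
  have "F x = (LINT y:{0<..x}|lborel. - \<rho> y)"
    unfolding F_def by (rule set_lebesgue_integral_cong) (use assms in \<open>auto simp: f_def c_eq\<close>)
  then show ?thesis by (simp add: set_integral_uminus set_integrable_\<rho>_0)
qed

lemma F_nonpos:
  assumes "0 < x" "x \<le> z"
  shows "F x \<le> 0"
  using F_eq[OF assms] \<rho>_nonneg by (simp add: set_lebesgue_integral_def)

text \<open>\<open>V' = - s' F\<close>, where \<open>s'\<close> is positive and \<open>F\<close> is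
  nonpositive below \<open>z\<close> because the cost is -1 there.\<close>

lemma V_mono:
  assumes "0 < u" "u \<le> v" "v < p"
  shows "V u \<le> V v"
proof -
  note D = primitive_onD[OF primitive_V assms(1,2)]
  have "0 \<le> integral {u..v} (\<lambda>x. - (s' x * F x))"
    by (intro integral_nonneg D)
       (use assms p F_nonpos in \<open>auto simp: mult_nonneg_nonpos less_imp_le[OF s'_pos]\<close>)
  then show ?thesis using D(3) assms p by simp
qed

lemma set_integrable_s\<rho>:
  assumes "0 < x"
  shows "set_integrable lborel {x..y} (\<lambda>y. - s y * \<rho> y)"
  by (intro set_integrable_continuous_mult[OF set_integrable_\<rho>] continuous_intros continuous_s)
     (use assms in auto)

lemma s\<rho>_borel: "S \<in> sets borel \<Longrightarrow> S \<subseteq> {0<..} \<Longrightarrow> set_borel_measurable lborel S (\<lambda>y. - s y * \<rho> y)"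
  by (intro set_borel_measurable_positive borel_measurable_times \<rho>_borel borel_continuous
      continuous_intros continuous_s)

lemma s\<rho>_nonneg: "0 < y \<Longrightarrow> 0 \<le> - s y * \<rho> y"
  using s_neg[of y] \<rho>_nonneg[of y] by (intro mult_nonneg_nonneg) auto

text \<open>All dependence on \<open>x\<close> sits in two nonpositive terms; both boundary cases
  are read off from this form.\<close>

lemma V_near_0:
  assumes "0 < x" "x < p"
  shows "V x = H p - H r + s x * (LINT y:{0<..x}|lborel. \<rho> y) - (LINT y:{x..p}|lborel. - s y * \<rho> y)"
proof -
  have "H p - H x = integral {x..p} (\<lambda>y. s y * f y)"
    by (rule primitive_onD(3)[OF primitive_H[of "p + 1"], symmetric]) (use assms in auto)
  also have "\<dots> = (LINT y:{x..p}|lborel. s y * f y)"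
    by (rule set_borel_integral_eq_integral(2)[OF set_integrable_sf, symmetric]) (use assms in auto)
  also have "\<dots> = (LINT y:{x..p}|lborel. - s y * \<rho> y)"
    by (rule set_lebesgue_integral_cong) (use assms p in \<open>auto simp: f_def c_eq\<close>)
  finally show ?thesis
    using V_eq[of x] F_eq[of x] assms p by simp
qed

text \<open>The constant multiple \<open>s 1 * \<rho>\<close> is integrable on
  \<open>{0<..1}\<close>, so \<open>s 1 - s\<close> may be replaced by \<open>- s\<close>; moving
  the right end from 1 to \<open>p\<close> changes only a part bounded away from the origin.\<close>

lemma origin_entrance_iff:
  "origin_entrance s m \<longleftrightarrow> set_integrable lborel {0<..p} (\<lambda>y. - s y * \<rho> y)"
proof -
  have cont: "continuous_on {0<..} (\<lambda>y. s 1 - s y)" by (intro continuous_intros continuous_s)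
  have nonneg: "0 \<le> (s 1 - s y) * \<rho> y" if "y \<in> {0<..1}" for y
    using s_strict_mono[of y 1] that \<rho>_nonneg[of y]
    by (intro mult_nonneg_nonneg) (cases "y = 1"; force)+
  have "origin_entrance s m \<longleftrightarrow> (\<integral>\<^sup>+ y\<in>{0<..1}. ennreal ((s 1 - s y) * \<rho> y) \<partial>lborel) < \<infinity>"
    unfolding origin_entrance_def by (subst nn_integral_speed[OF borel_continuous[OF cont]]) auto
  also have "\<dots> \<longleftrightarrow> set_integrable lborel {0<..1} (\<lambda>y. (s 1 - s y) * \<rho> y)"
    by (rule set_integrable_nonneg_iff[symmetric])
       (auto intro!: set_borel_measurable_positive borel_measurable_times \<rho>_borel borel_continuous[OF cont] nonneg)
  also have "\<dots> \<longleftrightarrow> set_integrable lborel {0<..1} (\<lambda>y. - s y * \<rho> y)"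
  proof
    have \<rho>: "set_integrable lborel {0<..1} (\<lambda>y. s 1 * \<rho> y)"
      by (intro set_integrable_mult_right set_integrable_\<rho>_0)
    show "set_integrable lborel {0<..1} (\<lambda>y. - s y * \<rho> y)"
      if "set_integrable lborel {0<..1} (\<lambda>y. (s 1 - s y) * \<rho> y)"
      using set_integral_diff(1)[OF that \<rho>] by (simp add: algebra_simps)
    show "set_integrable lborel {0<..1} (\<lambda>y. (s 1 - s y) * \<rho> y)"
      if "set_integrable lborel {0<..1} (\<lambda>y. - s y * \<rho> y)"
      using set_integral_add(1)[OF that \<rho>] by (simp add: algebra_simps)
  qed
  also have "\<dots> \<longleftrightarrow> set_integrable lborel {0<..p} (\<lambda>y. - s y * \<rho> y)"
  proof
    assume "set_integrable lborel {0<..p} (\<lambda>y. - s y * \<rho> y)"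
    then have "set_integrable lborel ({0<..p} \<union> {p..1}) (\<lambda>y. - s y * \<rho> y)"
      by (rule set_integrable_Un[OF _ set_integrable_s\<rho>]) (use p in auto)
    then show "set_integrable lborel {0<..1} (\<lambda>y. - s y * \<rho> y)"
      by (rule set_integrable_subset) auto
  next
    assume "set_integrable lborel {0<..1} (\<lambda>y. - s y * \<rho> y)"
    then show "set_integrable lborel {0<..p} (\<lambda>y. - s y * \<rho> y)"
      by (rule set_integrable_subset) (use p in auto)
  qed
  finally show ?thesis .
qed

lemma V_at_right_0: "((\<lambda>x. ereal (V x)) \<longlongrightarrow> (INF x\<in>{0<..<p}. ereal (V x))) (at_right 0)"
  by (rule filterlim_at_right_INF[OF V_mono p(1)])

text \<open>A lower bound for \<open>V\<close> would bound the integrals of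
  \<open>- s \<rho>\<close> over \<open>{x..p}\<close> uniformly, since the other term in
  \<open>V_near_0\<close> is nonpositive; then \<open>- s \<rho>\<close> would be integrable at the
  origin, which is the entrance case.\<close>

lemma V_limit_natural:
  assumes "origin_natural s m"
  shows "(INF x\<in>{0<..<p}. ereal (V x)) = -\<infinity>"
proof (rule ccontr)
  assume "(INF x\<in>{0<..<p}. ereal (V x)) \<noteq> -\<infinity>"
  then obtain B where B: "ereal B < (INF x\<in>{0<..<p}. ereal (V x))"
    by (metis ereal_dense2 ereal_infty_less(2) less_ereal.simps)
  have V_ge: "B \<le> V x" if "x \<in> {0<..<p}" for x
    using less_INF_D[OF B that] by simp
  have bound: "(LINT y:{x..p}|lborel. - s y * \<rho> y) \<le> H p - H r - B" if x: "0 < x" "x < p" for x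
  proof -
    have "s x * (LINT y:{0<..x}|lborel. \<rho> y) \<le> 0"
      using s_neg[OF x(1)] \<rho>_nonneg
      by (intro mult_nonpos_nonneg) (auto simp: set_lebesgue_integral_def)
    then show ?thesis using V_near_0[OF x] V_ge[of x] x by simp
  qed
  have "set_integrable lborel {0<..p} (\<lambda>y. - s y * \<rho> y)"
    by (rule set_integrable_if_integrals_bounded[OF set_integrable_s\<rho> s\<rho>_borel s\<rho>_nonneg bound])
       (use p in auto)
  then show False
    using assms origin_entrance_iff by (simp add: origin_natural_def origin_entrance_def)
qed

text \<open>As \<open>s\<close> increases, \<open>- s x \<le> - s y\<close> for
  \<open>y \<le> x\<close>. Hence the term with the factor \<open>s x\<close> is absorbed by the
  integral of \<open>- s \<rho>\<close> over \<open>{0<..x}\<close>, and both terms together cost at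
  most the finite integral \<open>B\<close>.\<close>

lemma V_limit_entrance:
  assumes "origin_entrance s m"
  shows "(INF x\<in>{0<..<p}. ereal (V x)) > -\<infinity>"
proof -
  define B where "B = (LINT y:{0<..p}|lborel. - s y * \<rho> y)"
  have int: "set_integrable lborel {0<..p} (\<lambda>y. - s y * \<rho> y)"
    using assms origin_entrance_iff by simp
  have "H p - H r - B \<le> V x" if x: "0 < x" "x < p" for x
  proof -
    have int_x: "set_integrable lborel {0<..x} (\<lambda>y. - s y * \<rho> y)"
      by (rule set_integrable_subset[OF int]) (use x in auto)
    have "- s x * (LINT y:{0<..x}|lborel. \<rho> y) = (LINT y:{0<..x}|lborel. - s x * \<rho> y)"
      by (rule set_integral_mult_right[symmetric])
    also have "\<dots> \<le> (LINT y:{0<..x}|lborel. - s y * \<rho> y)"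
    proof (rule set_integral_mono[OF _ int_x])
      show "set_integrable lborel {0<..x} (\<lambda>y. - s x * \<rho> y)"
        by (intro set_integrable_mult_right set_integrable_\<rho>_0)
      show "- s x * \<rho> y \<le> - s y * \<rho> y" if "y \<in> {0<..x}" for y
        using s_strict_mono[of y x] that by (intro mult_right_mono \<rho>_nonneg) (cases "y = x"; force)
    qed
    finally have "- s x * (LINT y:{0<..x}|lborel. \<rho> y) \<le> (LINT y:{0<..x}|lborel. - s y * \<rho> y)" .
    moreover have "B = (LINT y:{0<..x}|lborel. - s y * \<rho> y) + (LINT y:{x..p}|lborel. - s y * \<rho> y)"
    proof -
      have "{0<..p} = {0<..x} \<union> {x..p}" using x by auto
      moreover have "AE y in lborel. \<not> (y \<in> {0<..x} \<and> y \<in> {x..p})"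
        using AE_lborel_singleton[of x] by eventually_elim auto
      ultimately show ?thesis
        unfolding B_def using x by (simp only:) (intro set_integral_Un_AE int_x set_integrable_s\<rho>; simp)
    qed
    ultimately show ?thesis using V_near_0[OF x] by simp
  qed
  then have "ereal (H p - H r - B) \<le> (INF x\<in>{0<..<p}. ereal (V x))"
    by (intro INF_greatest) auto
  then show ?thesis by (rule less_le_trans[rotated]) simp
qed

end

theorem proposition4p1:
  fixes a b :: "real \<Rightarrow> real" and \<kappa> K z r :: real
  defines "s \<equiv> scale_fun a b \<kappa> K"
  defines "m \<equiv> speed_measure a s"
  defines "c \<equiv> cost s z"
  defines "V \<equiv> Vtilde s m c r"
  assumes a_borel: "a \<in> borel_measurable (restrict_space borel {0<..})"
    and b_borel: "b \<in> borel_measurable (restrict_space borel {0<..})"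
    and a_pos: "\<And>x. x > 0 \<Longrightarrow> a x > 0"
    and b_nonneg: "\<And>x. x > 0 \<Longrightarrow> b x \<ge> 0"
    and loc_int: "locally_integrable_coeffs a b"
    and s_0: "filterlim s at_bot (at_right 0)"
    and s_inf: "(s \<longlongrightarrow> 0) at_top"
    and m_fin: "emeasure m {0<..1} < \<infinity>"
    and z_pos: "z > 0"
    and r_pos: "r > 0"
    and r_zero: "(LINT y:{0<..r}|m. c y) = 0"
  shows "(origin_natural s m \<longrightarrow>
            solves_generator_ode a b c r V \<and>
            (V \<longlongrightarrow> 0) (at_left r) \<and> (deriv V \<longlongrightarrow> 0) (at_left r) \<and>
            ((\<lambda>x. ereal (V x)) \<longlongrightarrow> -\<infinity>) (at_right 0)) \<and>
         (origin_entrance s m \<longrightarrow>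
            solves_generator_ode a b c r V \<and>
            (V \<longlongrightarrow> 0) (at_left r) \<and> (deriv V \<longlongrightarrow> 0) (at_left r) \<and>
            (\<exists>L. ((\<lambda>x. ereal (V x)) \<longlongrightarrow> L) (at_right 0) \<and> L > -\<infinity>))"
proof -
  interpret transient_diffusion a b \<kappa> K z r
    by unfold_locales
       (use a_borel b_borel a_pos loc_int s_inf m_fin z_pos r_pos r_zero in
         \<open>simp_all add: s_def m_def c_def\<close>)
  \<comment> \<open>The infimum over \<open>{0<..<p}\<close> is the limit at the origin in both
    cases; it serves as the witness \<open>L\<close>.\<close>
  show ?thesis
    unfolding V_def c_def m_def s_def
    using solves_generator_ode_V V_at_left_r deriv_V_at_left_r V_at_right_0
      V_limit_natural V_limit_entrance by metis
qed

end
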